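(* For any color-critical graph $F$ with chromatic number $\chi(F)=r+1\geq 4$, there exists $n_0$ such that if $G$ is an $F$-free graph on $n\geq n_0$ vertices with $m$ edges, then \[ \sum_{v\in V(G)} d^2(v)\leq 2\left(1-\frac{1}{r}\right)mn, \] where the equality holds if and only if $G$ is a regular complete $r$-partite graph.
   Context: All graphs are finite and simple. $V(G)$ is the vertex set of $G$, $d(v)$ denotes the degree of the vertex $v$ in $G$, and $d^2(v)=(d(v))^2$. A graph $G$ is $F$-free if it contains no subgraph (not necessarily induced) isomorphic to $F$. A graph $F$ is color-critical if there is an edge $e$ of $F$ with $\chi(F-e)<\chi(F)$, where $F-e$ is obtained from $F$ by deleting the edge $e$ and $\chi$ denotes the chromatic number. A regular complete $r$-partite graph is a complete $r$-partite graph (with $r$ nonempty parts) all of whose vertices have the same degree, i.e. the parts all have equal size.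
   Formalization: The equality characterization is stated only for graphs with m > 0 edges, since an edgeless graph is F-free and gives 0 = 0 without being complete r-partite; G has natural numbers as vertices, which covers every finite graph up to isomorphism. *)

theory Defs
  imports Complex_Main "HOL-Library.Disjoint_Sets"
begin

record 'a sgraph =
  verts :: "'a set"
  edges :: "'a set set"

definition simple_graph :: "'a sgraph \<Rightarrow> bool" where
  "simple_graph G \<longleftrightarrow> finite (verts G) \<and> (\<forall>e\<in>edges G. e \<subseteq> verts G \<and> card e = 2)"

definition degree :: "'a sgraph \<Rightarrow> 'a \<Rightarrow> nat" where
  "degree G v = card {e \<in> edges G. v \<in> e}"

definition subgraph :: "'a sgraph \<Rightarrow> 'a sgraph \<Rightarrow> bool" where
  "subgraph H G \<longleftrightarrow> simple_graph H \<and> verts H \<subseteq> verts G \<and> edges H \<subseteq> edges G"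

definition isomorphic :: "'a sgraph \<Rightarrow> 'b sgraph \<Rightarrow> bool" where
  "isomorphic G H \<longleftrightarrow> (\<exists>f. bij_betw f (verts G) (verts H) \<and>
     (\<forall>u\<in>verts G. \<forall>v\<in>verts G. {u, v} \<in> edges G \<longleftrightarrow> {f u, f v} \<in> edges H))"

definition free_of :: "'a sgraph \<Rightarrow> 'b sgraph \<Rightarrow> bool" where
  "free_of F G \<longleftrightarrow> \<not> (\<exists>H. subgraph H G \<and> isomorphic F H)"

definition colorable :: "'a sgraph \<Rightarrow> nat \<Rightarrow> bool" where
  "colorable G k \<longleftrightarrow> (\<exists>c :: 'a \<Rightarrow> nat. (\<forall>v\<in>verts G. c v < k) \<and>
     (\<forall>u v. {u, v} \<in> edges G \<longrightarrow> c u \<noteq> c v))"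

definition chromatic_number :: "'a sgraph \<Rightarrow> nat" where
  "chromatic_number G = (LEAST k. colorable G k)"

definition delete_edge :: "'a sgraph \<Rightarrow> 'a set \<Rightarrow> 'a sgraph" where
  "delete_edge G e = G\<lparr>edges := edges G - {e}\<rparr>"

definition color_critical :: "'a sgraph \<Rightarrow> bool" where
  "color_critical F \<longleftrightarrow>
     (\<exists>e\<in>edges F. chromatic_number (delete_edge F e) < chromatic_number F)"

(* The blocks of a partition_on are nonempty by definition, so there are exactly r nonempty parts. *)
definition complete_partite :: "nat \<Rightarrow> 'a sgraph \<Rightarrow> bool" where
  "complete_partite r G \<longleftrightarrow> (\<exists>P. partition_on (verts G) P \<and> finite P \<and> card P = r \<and>
     (\<forall>u\<in>verts G. \<forall>v\<in>verts G. {u, v} \<in> edges G \<longleftrightarrow> \<not> (\<exists>p\<in>P. u \<in> p \<and> v \<in> p)))"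

definition regular :: "'a sgraph \<Rightarrow> bool" where
  "regular G \<longleftrightarrow> (\<forall>u\<in>verts G. \<forall>v\<in>verts G. degree G u = degree G v)"

end

theory Submission
  imports Defs "HOL-Analysis.Convex"
begin

text \<open>
  Let \<open>G\<close> have \<open>n\<close> vertices, \<open>m\<close> edges and \<open>k\<^sub>s\<close> cliques of size \<open>s\<close>. Sorting the vertices by the number
  of ends of an edge \<open>uv\<close> that they see gives \<open>d(u) + d(v) = n + t(uv) - z(uv)\<close>, where \<open>t\<close> counts the
  common neighbours and \<open>z\<close> the vertices that see neither end. Summing over the edges,
  \<open>\<Sum>d\<^sup>2 = nm + 3k\<^sub>3 - \<Sum>z\<close>. If \<open>G\<close> has no clique of size \<open>r + 1\<close>, the Moon--Moser inequalities give
  \<open>3k\<^sub>3 \<le> (1 - 2/r)nm\<close>, and the bound follows. An \<open>F\<close>-free graph may contain such cliques, but only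
  \<open>o(n\<^bsup>r+1\<^esup>)\<close> of them (\<open>many_cliques_give_blowup\<close>), so this argument yields the bound up to a small
  error. The exact bound and the extremal graphs come from stability. Call the difference between
  the right-hand and the left-hand side the gap.

  If the gap is not positive and \<open>G\<close> has an edge, then \<open>G\<close> is dense, and all the inequalities used are
  nearly equalities: almost every edge has \<open>t \<approx> (1 - 2/r)n\<close> and \<open>z \<approx> 0\<close>, hence
  \<open>d(u) + d(v) \<approx> 2(1 - 1/r)n\<close>. Comparing the three edges of a triangle turns this statement on pairs
  into one on single vertices: almost all degrees are close to \<open>(1 - 1/r)n\<close>
  (\<open>nonpos_gap_degrees_concentrate\<close>). Triangles are plentiful because \<open>r \<ge> 3\<close>. In that situation the
  removal of a vertex of degree below \<open>(1 - 1/r - \<epsilon>)n\<close> lowers the gap by at least \<open>\<epsilon>n\<^sup>2/2\<close>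
  (\<open>gap_drops_at_low_degree_vertex\<close>).

  On the other hand, a large \<open>F\<close>-free graph with minimum degree at least \<open>(1 - 1/r - \<epsilon>)n\<close> is
  \<open>r\<close>-colourable (\<open>min_degree_forces_colouring\<close>), and for such a graph an explicit formula
  (\<open>multipartite_gap_eq\<close>) shows that the gap is nonnegative and vanishes only for the balanced
  complete \<open>r\<close>-partite graph. Removing low-degree vertices one at a time therefore ends in a graph of
  bounded order or of nonnegative gap, so the gap of every \<open>F\<close>-free graph is bounded below by a
  constant. If \<open>n\<close> is large and the gap is not positive, then not even one vertex of low degree can
  exist, since its removal would push the gap below that constant. So \<open>G\<close> is \<open>r\<close>-colourable, and the
  formula identifies it (\<open>nonpos_gap_structure\<close>).

  Color-criticality enters through \<open>free_of_imp_plus_edge_free\<close>: \<open>F\<close> embeds into a large complete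
  \<open>r\<close>-partite graph with one extra edge inside a part, so \<open>G\<close> does not contain this configuration. All
  statements speak of an edge set \<open>E\<close> and a vertex set \<open>S\<close>, which makes the removal of a vertex or the
  passage to a neighbourhood a change of \<open>S\<close> alone.
\<close>

section \<open>Counting cliques\<close>

definition loopfree :: "'v set set \<Rightarrow> bool" where
  "loopfree E \<longleftrightarrow> (\<forall>v. {v} \<notin> E)"

definition common_nbrs :: "'v set set \<Rightarrow> 'v set \<Rightarrow> 'v set \<Rightarrow> 'v set" where
  "common_nbrs E S K = {w \<in> S. \<forall>u\<in>K. {u, w} \<in> E}"

abbreviation deg :: "'v set set \<Rightarrow> 'v set \<Rightarrow> 'v \<Rightarrow> nat" where
  "deg E S v \<equiv> card (common_nbrs E S {v})"

definition cliques :: "'v set set \<Rightarrow> 'v set \<Rightarrow> nat \<Rightarrow> 'v set set" where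
  "cliques E S s = {K. K \<subseteq> S \<and> card K = s \<and> (\<forall>u\<in>K. \<forall>v\<in>K. u \<noteq> v \<longrightarrow> {u, v} \<in> E)}"

text \<open>The defect in the Moon--Moser count. For an edge these are the vertices adjacent to neither end.\<close>

definition twice_missed :: "'v set set \<Rightarrow> 'v set \<Rightarrow> 'v set \<Rightarrow> 'v set" where
  "twice_missed E S K =
     {w \<in> S. \<exists>u\<in>K. \<exists>v\<in>K. u \<noteq> v \<and> {u, w} \<notin> E \<and> {v, w} \<notin> E}"

lemma card_subsets_le_power:
  assumes "finite A"
  shows "card {T. T \<subseteq> A \<and> card T = k} \<le> card A ^ k"
  using assms by (cases "k \<le> card A") (simp_all add: n_subsets binomial_le_pow binomial_eq_0)

lemma finite_common_nbrs [simp]: "finite S \<Longrightarrow> finite (common_nbrs E S K)"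
  by (simp add: common_nbrs_def)

lemma finite_cliques [simp]: "finite S \<Longrightarrow> finite (cliques E S s)"
  by (rule finite_subset[of _ "Pow S"]) (auto simp: cliques_def)

lemma finite_clique: "finite S \<Longrightarrow> K \<in> cliques E S s \<Longrightarrow> finite K"
  by (auto simp: cliques_def intro: finite_subset)

lemma card_common_nbrs_le: "finite S \<Longrightarrow> card (common_nbrs E S K) \<le> card S"
  by (auto simp: common_nbrs_def intro: card_mono)

lemma common_nbrs_disjoint: "loopfree E \<Longrightarrow> w \<in> common_nbrs E S K \<Longrightarrow> w \<notin> K"
  by (force simp: common_nbrs_def loopfree_def)

lemma cliques_1: "cliques E S 1 = (\<lambda>v. {v}) ` S"
  by (auto simp: cliques_def card_1_singleton_iff)

lemma insert_clique:
  assumes "finite S" "loopfree E" "K \<in> cliques E S s" "v \<in> common_nbrs E S K"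
  shows "insert v K \<in> cliques E S (Suc s)"
proof -
  have "v \<notin> K" using assms common_nbrs_disjoint by metis
  moreover have "finite K" using assms finite_clique by metis
  ultimately show ?thesis
    using assms by (auto simp: cliques_def common_nbrs_def insert_commute)
qed

lemma remove_from_clique:
  assumes "finite S" "K \<in> cliques E S (Suc s)" "v \<in> K"
  shows "K - {v} \<in> cliques E S s" "v \<in> common_nbrs E S (K - {v})"
  using assms finite_clique[of S K E "Suc s"] by (auto simp: cliques_def common_nbrs_def)

text \<open>A clique \<open>K\<close> with a marked vertex \<open>v\<close> is the same as the clique \<open>K - {v}\<close> with a vertex extending it.
Every clique count below is an instance of this exchange.\<close>

lemma sum_cliques_Suc:
  fixes f :: "'v set \<Rightarrow> 'v \<Rightarrow> 'b::comm_monoid_add"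
  assumes "finite S" "loopfree E"
  shows "(\<Sum>K\<in>cliques E S (Suc s). \<Sum>v\<in>K. f (K - {v}) v)
       = (\<Sum>K\<in>cliques E S s. \<Sum>v\<in>common_nbrs E S K. f K v)"
proof -
  have "(\<Sum>K\<in>cliques E S (Suc s). \<Sum>v\<in>K. f (K - {v}) v)
      = (\<Sum>(K, v)\<in>Sigma (cliques E S (Suc s)) (\<lambda>K. K). f (K - {v}) v)"
    using assms finite_clique by (intro sum.Sigma) (auto dest: finite_clique)
  also have "\<dots> = (\<Sum>(K, v)\<in>Sigma (cliques E S s) (common_nbrs E S). f K v)"
    by (rule sum.reindex_bij_witness[where i = "\<lambda>(K, v). (insert v K, v)"
          and j = "\<lambda>(K, v). (K - {v}, v)"])
       (use assms in \<open>auto dest: remove_from_clique insert_clique common_nbrs_disjoint\<close>)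
  also have "\<dots> = (\<Sum>K\<in>cliques E S s. \<Sum>v\<in>common_nbrs E S K. f K v)"
    using assms by (intro sum.Sigma[symmetric]) auto
  finally show ?thesis .
qed

lemma sum_cliques_remove:
  fixes g :: "'v set \<Rightarrow> real"
  assumes "finite S" "loopfree E"
  shows "(\<Sum>K\<in>cliques E S (Suc s). \<Sum>v\<in>K. g (K - {v}))
       = (\<Sum>K\<in>cliques E S s. real (card (common_nbrs E S K)) * g K)"
  using sum_cliques_Suc[OF assms, where f = "\<lambda>K v. g K"] by simp

lemma sum_card_common_nbrs:
  assumes "finite S" "loopfree E"
  shows "(\<Sum>K\<in>cliques E S s. real (card (common_nbrs E S K))) = real (Suc s) * real (card (cliques E S (Suc s)))"
proof -
  have "(\<Sum>K\<in>cliques E S (Suc s). \<Sum>v\<in>K. (1::real)) = (\<Sum>K\<in>cliques E S (Suc s). real (Suc s))"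
    by (rule sum.cong) (auto simp: cliques_def)
  then show ?thesis
    using sum_cliques_remove[OF assms, where g = "\<lambda>_. 1" and s = s] by (simp add: mult.commute)
qed

lemma sum_sum_remove:
  fixes f :: "'v \<Rightarrow> real"
  assumes "finite K"
  shows "(\<Sum>v\<in>K. sum f (K - {v})) = (real (card K) - 1) * sum f K"
proof -
  have "(\<Sum>v\<in>K. sum f (K - {v})) = (\<Sum>v\<in>K. sum f K - f v)"
    using assms by (intro sum.cong) (auto simp: sum_diff1)
  then show ?thesis by (simp add: sum_subtractf algebra_simps)
qed

lemma sum_edges_ends:
  fixes f :: "'v \<Rightarrow> real"
  assumes "finite S" "loopfree E"
  shows "(\<Sum>e\<in>cliques E S 2. sum f e) = (\<Sum>u\<in>S. real (deg E S u) * f u)"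
proof -
  have "(\<Sum>e\<in>cliques E S 2. sum f e) = (\<Sum>e\<in>cliques E S (Suc 1). \<Sum>v\<in>e. sum f (e - {v}))"
  proof (rule sum.cong)
    fix e assume "e \<in> cliques E S (Suc 1)"
    then have "finite e" "card e = 2" using assms finite_clique by (auto simp: cliques_def)
    then show "sum f e = (\<Sum>v\<in>e. sum f (e - {v}))" by (simp add: sum_sum_remove)
  qed (simp add: numeral_2_eq_2)
  also have "\<dots> = (\<Sum>K\<in>cliques E S 1. real (card (common_nbrs E S K)) * sum f K)"
    by (rule sum_cliques_remove[OF assms])
  also have "\<dots> = (\<Sum>u\<in>S. real (deg E S u) * f u)"
    unfolding cliques_1 by (subst sum.reindex) auto
  finally show ?thesis .
qed

lemma sum_deg:
  assumes "finite S" "loopfree E"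
  shows "(\<Sum>u\<in>S. real (deg E S u)) = 2 * real (card (cliques E S 2))"
proof -
  have "(\<Sum>e\<in>cliques E S 2. \<Sum>u\<in>e. 1) = (\<Sum>e\<in>cliques E S 2. 2::real)"
    by (rule sum.cong) (auto simp: cliques_def)
  then show ?thesis using sum_edges_ends[OF assms, of "\<lambda>_. 1"] by simp
qed

text \<open>Sort the vertices of \<open>S\<close> by the number of members of \<open>K\<close> they are not adjacent to. A vertex that misses
none is counted \<open>s\<close> times on the left, one that misses exactly one is counted once, and the others only
in the defect term. A member of \<open>K\<close> misses exactly itself.\<close>

lemma clique_extension_count:
  assumes "finite S" "K \<in> cliques E S s" "s > 0"
  shows "(\<Sum>v\<in>K. real (card (common_nbrs E S (K - {v})))) + real (card (twice_missed E S K))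
       = real (card S) + (real s - 1) * real (card (common_nbrs E S K))"
proof -
  have finK: "finite K" and cK: "card K = s" and ne: "K \<noteq> {}"
    using assms finite_clique by (auto simp: cliques_def)
  have count: "real (card {w \<in> S. P w}) = (\<Sum>w\<in>S. of_bool (P w))" for P
    using assms(1) by (simp add: sum_of_bool_eq Collect_conj_eq)
  have pointwise: "(\<Sum>v\<in>K. of_bool (\<forall>u\<in>K - {v}. {u, w} \<in> E))
      + of_bool (\<exists>u\<in>K. \<exists>v\<in>K. u \<noteq> v \<and> {u, w} \<notin> E \<and> {v, w} \<notin> E)
      = 1 + (real s - 1) * of_bool (\<forall>u\<in>K. {u, w} \<in> E)" for w
  proof -
    consider "\<forall>u\<in>K. {u, w} \<in> E"
      | x where "x \<in> K" "{x, w} \<notin> E" "\<forall>u\<in>K - {x}. {u, w} \<in> E"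
      | x y where "x \<in> K" "y \<in> K" "x \<noteq> y" "{x, w} \<notin> E" "{y, w} \<notin> E"
      by blast
    then show ?thesis
    proof cases
      case 1
      then have "(\<Sum>v\<in>K. of_bool (\<forall>u\<in>K - {v}. {u, w} \<in> E)) = real s"
        using cK by (simp)
      then show ?thesis using 1 by auto
    next
      case 2
      then have "(\<Sum>v\<in>K. of_bool (\<forall>u\<in>K - {v}. {u, w} \<in> E)) = (\<Sum>v\<in>K. if v = x then 1 else 0 :: real)"
        by (intro sum.cong) auto
      also have "\<dots> = 1" using 2 finK by simp
      finally show ?thesis using 2 by auto
    next
      case 3
      then have "(\<Sum>v\<in>K. of_bool (\<forall>u\<in>K - {v}. {u, w} \<in> E)) = (\<Sum>v\<in>K. 0 :: real)"
        by (intro sum.cong) auto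
      then show ?thesis using 3 by auto
    qed
  qed
  have "(\<Sum>v\<in>K. real (card (common_nbrs E S (K - {v})))) + real (card (twice_missed E S K))
     = (\<Sum>w\<in>S. (\<Sum>v\<in>K. of_bool (\<forall>u\<in>K - {v}. {u, w} \<in> E))
      + of_bool (\<exists>u\<in>K. \<exists>v\<in>K. u \<noteq> v \<and> {u, w} \<notin> E \<and> {v, w} \<notin> E))"
    unfolding common_nbrs_def twice_missed_def count sum.distrib by (subst sum.swap) simp
  also have "\<dots> = (\<Sum>w\<in>S. 1 + (real s - 1) * of_bool (\<forall>u\<in>K. {u, w} \<in> E))"
    by (simp only: pointwise)
  also have "\<dots> = real (card S) + (real s - 1) * real (card (common_nbrs E S K))"
    unfolding common_nbrs_def count by (simp add: sum.distrib sum_distrib_left)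
  finally show ?thesis .
qed

lemma sum_common_nbrs_squared_le:
  assumes "finite S" "loopfree E"
  shows "(\<Sum>K\<in>cliques E S s. (real (card (common_nbrs E S K)))\<^sup>2)
    \<le> real (card S) * real (card (cliques E S (Suc s)))
       + real s * real (s + 2) * real (card (cliques E S (Suc (Suc s))))"
proof -
  have "(\<Sum>K\<in>cliques E S s. (real (card (common_nbrs E S K)))\<^sup>2)
      = (\<Sum>K\<in>cliques E S (Suc s). \<Sum>v\<in>K. real (card (common_nbrs E S (K - {v}))))"
    by (subst sum_cliques_remove[OF assms]) (simp add: power2_eq_square)
  also have "\<dots> \<le> (\<Sum>K\<in>cliques E S (Suc s). real (card S) + real s * real (card (common_nbrs E S K)))"
    by (rule sum_mono) (use clique_extension_count[OF assms(1)] in force)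
  also have "\<dots> = real (card S) * real (card (cliques E S (Suc s)))
       + real s * real (s + 2) * real (card (cliques E S (Suc (Suc s))))"
    by (simp add: sum.distrib sum_distrib_left[symmetric] sum_card_common_nbrs[OF assms] algebra_simps)
  finally show ?thesis .
qed

text \<open>Cauchy--Schwarz for the numbers of extensions of the cliques of size \<open>s\<close>, whose squares are summed by
the extension count.\<close>

lemma moon_moser:
  assumes "finite S" "loopfree E"
  shows "(real (Suc s) * real (card (cliques E S (Suc s))))\<^sup>2
    \<le> real (card (cliques E S s)) * (real (card S) * real (card (cliques E S (Suc s)))
       + real s * real (s + 2) * real (card (cliques E S (Suc (Suc s)))))"
proof -
  have "(real (Suc s) * real (card (cliques E S (Suc s))))\<^sup>2
      = (\<Sum>K\<in>cliques E S s. 1 * real (card (common_nbrs E S K)))\<^sup>2"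
    using sum_card_common_nbrs[OF assms, of s] by simp
  also have "\<dots> \<le> (\<Sum>K\<in>cliques E S s. 1\<^sup>2) * (\<Sum>K\<in>cliques E S s. (real (card (common_nbrs E S K)))\<^sup>2)"
    by (rule Cauchy_Schwarz_ineq_sum)
  also have "\<dots> \<le> real (card (cliques E S s)) * (real (card S) * real (card (cliques E S (Suc s)))
       + real s * real (s + 2) * real (card (cliques E S (Suc (Suc s)))))"
    using sum_common_nbrs_squared_le[OF assms, of s] by (simp add: mult_left_mono)
  finally show ?thesis .
qed

text \<open>In the balanced complete \<open>r\<close>-partite graph the ratio of consecutive clique numbers is
\<open>(1 - s/r) n / (s + 1)\<close>. These values satisfy the Moon--Moser recursion with equality, so a lower bound on
one ratio passes to the next one without loss.\<close>

lemma clique_ratio_lower_step: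
  assumes "finite S" "loopfree E" "r > 0" "s > 0" "cliques E S s \<noteq> {}"
    and "real (Suc s) * real (card (cliques E S (Suc s)))
        \<ge> (1 - real s / real r) * real (card S) * real (card (cliques E S s))"
  shows "real (Suc (Suc s)) * real (card (cliques E S (Suc (Suc s))))
        \<ge> (1 - real (Suc s) / real r) * real (card S) * real (card (cliques E S (Suc s)))"
proof -
  define n a b c where "n = real (card S)" and "a = real (card (cliques E S s))"
    and "b = real (card (cliques E S (Suc s)))" and "c = real (card (cliques E S (Suc (Suc s))))"
  have a: "a > 0" using assms by (simp add: a_def card_gt_0_iff)
  have b: "b \<ge> 0" by (simp add: b_def)
  have mm: "(real (Suc s) * b)\<^sup>2 \<le> a * (n * b + real s * real (s + 2) * c)"
    using moon_moser[OF assms(1,2), of s] by (simp add: a_def b_def c_def n_def)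
  have "(1 - real s / real r) * n * a * (real (Suc s) * b) \<le> (real (Suc s) * b) * (real (Suc s) * b)"
    using assms(6) b by (intro mult_right_mono) (auto simp: a_def b_def n_def)
  with mm have "a * ((1 - real s / real r) * n * real (Suc s) * b)
      \<le> a * (n * b + real s * real (s + 2) * c)"
    by (simp add: power2_eq_square algebra_simps)
  then have "(1 - real s / real r) * n * real (Suc s) * b \<le> n * b + real s * real (s + 2) * c"
    using a by simp
  moreover have "(1 - real s / real r) * n * real (Suc s) * b
      = n * b + real s * ((1 - real (Suc s) / real r) * n * b)"
    using assms(3) by (simp add: field_simps)
  ultimately have "real s * ((1 - real (Suc s) / real r) * n * b) \<le> real s * (real (s + 2) * c)"
    by simp
  then have "(1 - real (Suc s) / real r) * n * b \<le> real (s + 2) * c"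
    using assms(4) by simp
  then show ?thesis by (simp add: n_def b_def c_def)
qed

text \<open>The same recursion read downwards: an upper bound on a ratio passes to the previous one, and the error
\<open>\<eta>\<close> does not grow.\<close>

lemma clique_ratio_upper_step:
  fixes \<eta> :: real
  assumes "finite S" "loopfree E" "r > 0" "\<eta> \<ge> 0" "cliques E S (Suc s) \<noteq> {}"
    and "real (Suc (Suc s)) * real (card (cliques E S (Suc (Suc s))))
        \<le> (1 - real (Suc s) / real r + \<eta>) * real (card S) * real (card (cliques E S (Suc s)))"
  shows "real (Suc s) * real (card (cliques E S (Suc s)))
        \<le> (1 - real s / real r + \<eta>) * real (card S) * real (card (cliques E S s))"
proof -
  define n a b c where "n = real (card S)" and "a = real (card (cliques E S s))"
    and "b = real (card (cliques E S (Suc s)))" and "c = real (card (cliques E S (Suc (Suc s))))"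
  have b: "b > 0" using assms by (simp add: b_def card_gt_0_iff)
  have a: "a \<ge> 0" and n: "n \<ge> 0" by (simp_all add: a_def n_def)
  have mm: "(real (Suc s) * b)\<^sup>2 \<le> a * (n * b + real s * (real (s + 2) * c))"
    using moon_moser[OF assms(1,2), of s] by (simp add: a_def b_def c_def n_def mult.assoc)
  have "real (s + 2) * c \<le> (1 - real (Suc s) / real r + \<eta>) * n * b"
    using assms(6) by (simp add: n_def b_def c_def)
  then have "real s * (real (s + 2) * c) \<le> real s * ((1 - real (Suc s) / real r + \<eta>) * n * b)"
    by (rule mult_left_mono) simp
  then have "n * b + real s * (real (s + 2) * c)
      \<le> n * b + real s * ((1 - real (Suc s) / real r + \<eta>) * n * b)" by simp
  also have "\<dots> = (real (Suc s) * (1 - real s / real r) + real s * \<eta>) * n * b"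
    using assms(3) by (simp add: field_simps)
  also have "\<dots> \<le> (real (Suc s) * (1 - real s / real r) + real (Suc s) * \<eta>) * n * b"
    using assms(4) n b by (intro mult_right_mono) (auto simp: algebra_simps)
  finally have "a * (n * b + real s * (real (s + 2) * c))
      \<le> a * ((real (Suc s) * (1 - real s / real r) + real (Suc s) * \<eta>) * n * b)"
    using a by (rule mult_left_mono)
  with mm have "(real (Suc s) * b) * (real (Suc s) * b)
      \<le> (real (Suc s) * b) * ((1 - real s / real r + \<eta>) * n * a)"
    by (simp add: power2_eq_square algebra_simps)
  then show ?thesis
    using b unfolding n_def[symmetric] a_def[symmetric] b_def[symmetric]
    by (subst (asm) mult_le_cancel_left_pos) auto
qed

section \<open>Blow-ups of cliques\<close>

definition joined :: "'v set set \<Rightarrow> nat \<Rightarrow> (nat \<Rightarrow> 'v set) \<Rightarrow> bool" where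
  "joined E r P \<longleftrightarrow> (\<forall>i<r. \<forall>j<r. i \<noteq> j \<longrightarrow> (\<forall>x\<in>P i. \<forall>y\<in>P j. {x, y} \<in> E))"

lemma joinedD: "joined E r P \<Longrightarrow> i < r \<Longrightarrow> j < r \<Longrightarrow> i \<noteq> j \<Longrightarrow> x \<in> P i \<Longrightarrow> y \<in> P j \<Longrightarrow> {x, y} \<in> E"
  by (auto simp: joined_def)

text \<open>Excludes a complete \<open>r\<close>-partite graph with parts of size at least \<open>N\<close> together with one edge inside a
part. The parts of a joined family may span edges, so this is about subgraphs that need not be induced.\<close>

definition plus_edge_free :: "'v set set \<Rightarrow> 'v set \<Rightarrow> nat \<Rightarrow> nat \<Rightarrow> bool" where
  "plus_edge_free E S r N \<longleftrightarrow> \<not> (\<exists>P i u v. joined E r P \<and> (\<forall>j<r. P j \<subseteq> S \<and> N \<le> card (P j)) \<and>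
      i < r \<and> u \<in> P i \<and> v \<in> P i \<and> {u, v} \<in> E)"

lemma plus_edge_free_subset: "plus_edge_free E S r N \<Longrightarrow> S' \<subseteq> S \<Longrightarrow> plus_edge_free E S' r N"
  unfolding plus_edge_free_def by (meson subset_trans)

lemma joined_update:
  assumes "joined E r P" "i < r"
    and "\<And>j x y. j < r \<Longrightarrow> j \<noteq> i \<Longrightarrow> x \<in> A \<Longrightarrow> y \<in> P j \<Longrightarrow> {x, y} \<in> E"
  shows "joined E r (P(i := A))"
  unfolding joined_def
proof (intro allI impI ballI)
  fix k l x y
  assume *: "k < r" "l < r" "k \<noteq> l" "x \<in> (P(i := A)) k" "y \<in> (P(i := A)) l"
  consider "k = i" "l \<noteq> i" | "k \<noteq> i" "l = i" | "k \<noteq> i" "l \<noteq> i" using * by auto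
  then show "{x, y} \<in> E"
  proof cases
    case 1
    then show ?thesis using assms(3)[of l x y] * by auto
  next
    case 2
    then show ?thesis using assms(3)[of k y x] * by (auto simp: insert_commute)
  next
    case 3
    then show ?thesis using assms(1) * by (auto dest: joinedD)
  qed
qed

text \<open>Both ends of such an edge could be added to part \<open>i\<close>, because they see all vertices of the other
parts.\<close>

lemma no_edge_in_part:
  assumes "plus_edge_free E S r N" "finite S" "joined E r P" "\<And>j. j < r \<Longrightarrow> P j \<subseteq> S \<and> N \<le> card (P j)"
    and "i < r" "u \<in> S" "v \<in> S"
    and "\<And>j. j < r \<Longrightarrow> j \<noteq> i \<Longrightarrow> P j \<subseteq> common_nbrs E S {u} \<inter> common_nbrs E S {v}"
  shows "{u, v} \<notin> E"
proof
  assume uv: "{u, v} \<in> E"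
  define Q where "Q = P(i := insert u (insert v (P i)))"
  have "joined E r Q"
    unfolding Q_def
  proof (rule joined_update[OF assms(3,5)])
    fix j x y assume *: "j < r" "j \<noteq> i" "x \<in> insert u (insert v (P i))" "y \<in> P j"
    then show "{x, y} \<in> E"
      using assms(8)[of j] joinedD[OF assms(3,5), of j x y] by (auto simp: common_nbrs_def)
  qed
  moreover have "Q j \<subseteq> S \<and> N \<le> card (Q j)" if "j < r" for j
  proof (cases "j = i")
    case True
    have "card (P i) \<le> card (Q i)"
      using assms(2,4,6,7) that True unfolding Q_def
      by (intro card_mono) (auto intro: finite_subset)
    then show ?thesis using assms(4)[of i] assms(5-7) True by (auto simp: Q_def)
  next
    case False
    then show ?thesis using assms(4) that by (simp add: Q_def)
  qed
  moreover have "u \<in> Q i" "v \<in> Q i" by (auto simp: Q_def)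
  ultimately show False
    using assms(1,5) uv unfolding plus_edge_free_def by blast
qed

text \<open>Otherwise the neighbours of \<open>v\<close> in the parts form a joined family themselves, and \<open>v\<close> together with one of
its neighbours in part 0 is an edge that \<open>no_edge_in_part\<close> rules out.\<close>

lemma few_neighbours_in_some_part:
  assumes "plus_edge_free E S r N" "finite S" "joined E r P" "\<And>j. j < r \<Longrightarrow> P j \<subseteq> S" "v \<in> S" "N > 0" "r > 0"
  shows "\<exists>i<r. card (common_nbrs E S {v} \<inter> P i) < N"
proof (rule ccontr)
  assume "\<not> ?thesis"
  then have big: "N \<le> card (common_nbrs E S {v} \<inter> P i)" if "i < r" for i using that by (meson not_le)
  then have "card (common_nbrs E S {v} \<inter> P 0) \<noteq> 0" using assms by force
  then obtain u where u: "u \<in> common_nbrs E S {v}" "u \<in> P 0" by (metis Int_iff card.empty ex_in_conv)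
  have "{u, v} \<notin> E"
  proof (rule no_edge_in_part[OF assms(1,2), of "\<lambda>i. common_nbrs E S {v} \<inter> P i" 0])
    show "joined E r (\<lambda>i. common_nbrs E S {v} \<inter> P i)" using assms(3) by (auto simp: joined_def)
    show "common_nbrs E S {v} \<inter> P j \<subseteq> common_nbrs E S {u} \<inter> common_nbrs E S {v}" if "j < r" "j \<noteq> 0" for j
      using joinedD[OF assms(3), of 0 j u] u that assms(7) by (auto simp: common_nbrs_def)
  qed (use assms big u in \<open>auto simp: common_nbrs_def\<close>)
  then show False using u by (auto simp: common_nbrs_def insert_commute)
qed

text \<open>The theorem of Erdos on complete multipartite hypergraphs, for the hypergraph of cliques, where it has a
short induction. If there are many cliques of size \<open>s + 1\<close>, then many cliques of size \<open>s\<close> have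
linearly many extensions, so some set \<open>T\<close> of size \<open>t\<close> consists of extensions of many of them. These
cliques all lie in the common neighbourhood of \<open>T\<close>, to which the induction hypothesis applies, and
\<open>T\<close> becomes the last part. The number \<open>n\<close> only bounds the order of the graph, so that it can stay the
same when the vertex set shrinks.\<close>

lemma many_cliques_give_blowup:
  fixes \<epsilon> :: real
  assumes "\<epsilon> > 0"
  shows "\<exists>n0. \<forall>n\<ge>n0. \<forall>E (S :: 'v set). finite S \<longrightarrow> loopfree E \<longrightarrow> card S \<le> n \<longrightarrow>
      \<epsilon> * real n ^ s \<le> real (card (cliques E S s)) \<longrightarrow>
      (\<exists>P. joined E s P \<and> (\<forall>i<s. P i \<subseteq> S \<and> card (P i) = t))"
  using assms
proof (induction s arbitrary: \<epsilon>)
  case 0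
  then show ?case by (auto simp: joined_def)
next
  case (Suc s)
  show ?case
  proof (cases "t = 0")
    case True
    then show ?thesis by (intro exI[of _ 0]) (auto simp: joined_def intro!: exI[of _ "\<lambda>_. {}"])
  next
    case False
    define \<epsilon>' where "\<epsilon>' = \<epsilon> / 2 * (\<epsilon> / (2 * real t)) ^ t"
    have "\<epsilon>' > 0" using Suc.prems False by (simp add: \<epsilon>'_def)
    from Suc.IH[OF this] obtain n1 where n1: "\<And>n E (S :: 'v set). n1 \<le> n \<Longrightarrow> finite S \<Longrightarrow> loopfree E \<Longrightarrow>
        card S \<le> n \<Longrightarrow> \<epsilon>' * real n ^ s \<le> real (card (cliques E S s)) \<Longrightarrow>
        \<exists>P. joined E s P \<and> (\<forall>i<s. P i \<subseteq> S \<and> card (P i) = t)" by metis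
    define n0 where "n0 = max (Suc n1) (nat \<lceil>2 * real t / \<epsilon>\<rceil>)"
    show ?thesis
    proof (intro exI[of _ n0] allI impI)
      fix n E and S :: "'v set"
      assume n: "n0 \<le> n" and S: "finite S" "loopfree E" "card S \<le> n"
        and many: "\<epsilon> * real n ^ Suc s \<le> real (card (cliques E S (Suc s)))"
      have npos: "n > 0" "n1 \<le> n" using n by (auto simp: n0_def)
      have "2 * real t / \<epsilon> \<le> real n" using n unfolding n0_def by linarith
      then have nt: "real t \<le> \<epsilon> / 2 * real n" using Suc.prems by (simp add: field_simps)
      have subsets_le: "card {T. T \<subseteq> S \<and> card T = k} \<le> n ^ k" for k
        using card_subsets_le_power[OF S(1), of k] power_mono[OF S(3), of k] by linarith
      have ks: "card (cliques E S s) \<le> n ^ s"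
      proof -
        have "card (cliques E S s) \<le> card {T. T \<subseteq> S \<and> card T = s}"
          using S by (intro card_mono) (auto simp: cliques_def)
        with subsets_le[of s] show ?thesis by linarith
      qed
      \<comment> \<open>The cliques with linearly many extensions.\<close>
      define R where "R = {K \<in> cliques E S s. \<epsilon> / 2 * real n \<le> real (card (common_nbrs E S K))}"
      have finR: "finite R" using S by (simp add: R_def)
      have "\<epsilon> * real n ^ Suc s \<le> real (Suc s) * real (card (cliques E S (Suc s)))"
        by (rule order_trans[OF many]) (simp add: mult_le_cancel_right1)
      also have "\<dots> = (\<Sum>K\<in>cliques E S s. real (card (common_nbrs E S K)))"
        using sum_card_common_nbrs[OF S(1,2)] by simp
      also have "\<dots> \<le> (\<Sum>K\<in>cliques E S s. real n * of_bool (K \<in> R) + \<epsilon> / 2 * real n)"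
      proof (rule sum_mono)
        fix K assume K: "K \<in> cliques E S s"
        have "card (common_nbrs E S K) \<le> n" using S card_common_nbrs_le le_trans by blast
        then show "real (card (common_nbrs E S K)) \<le> real n * of_bool (K \<in> R) + \<epsilon> / 2 * real n"
          using K Suc.prems by (auto simp: R_def add_increasing2)
      qed
      also have "\<dots> = real n * real (card R) + \<epsilon> / 2 * real n * real (card (cliques E S s))"
      proof -
        have "(\<Sum>K\<in>cliques E S s. of_bool (K \<in> R)) = real (card R)"
          using S by (simp add: sum_of_bool_eq Int_absorb1 R_def Int_def conj_commute)
        then show ?thesis by (simp add: sum.distrib sum_distrib_left[symmetric])
      qed
      also have "\<epsilon> / 2 * real n * real (card (cliques E S s)) \<le> \<epsilon> / 2 * real n * real n ^ s"
        using ks Suc.prems by (intro mult_left_mono) (auto simp: of_nat_power[symmetric] simp del: of_nat_power)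
      finally have "real n * (\<epsilon> / 2 * real n ^ s) \<le> real n * real (card R)" by (simp add: field_simps)
      then have cardR: "\<epsilon> / 2 * real n ^ s \<le> real (card R)" using npos by simp
      define \<T> where "\<T> = {T. T \<subseteq> S \<and> card T = t}"
      have fin\<T>: "finite \<T>" using S by (simp add: \<T>_def)
      have rich: "(\<epsilon> / (2 * real t)) ^ t * real n ^ t \<le> real (card {T \<in> \<T>. T \<subseteq> common_nbrs E S K})" if "K \<in> R" for K
      proof -
        have *: "\<epsilon> / 2 * real n \<le> real (card (common_nbrs E S K))" using that by (simp add: R_def)
        have "{T \<in> \<T>. T \<subseteq> common_nbrs E S K} = {T. T \<subseteq> common_nbrs E S K \<and> card T = t}"
          by (auto simp: \<T>_def common_nbrs_def)
        then have "card {T \<in> \<T>. T \<subseteq> common_nbrs E S K} = card (common_nbrs E S K) choose t"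
          using S by (simp add: n_subsets)
        moreover have "(real (card (common_nbrs E S K)) / real t) ^ t \<le> real (card (common_nbrs E S K) choose t)"
          using * nt by (intro binomial_ge_n_over_k_pow_k) simp
        moreover have "(\<epsilon> / (2 * real t) * real n) ^ t \<le> (real (card (common_nbrs E S K)) / real t) ^ t"
          using * Suc.prems False by (intro power_mono) (auto simp: field_simps)
        ultimately show ?thesis by (simp flip: power_mult_distrib)
      qed
      have "\<epsilon>' * real n ^ s * real n ^ t = (\<epsilon> / 2 * real n ^ s) * ((\<epsilon> / (2 * real t)) ^ t * real n ^ t)"
        by (simp add: \<epsilon>'_def)
      also have "\<dots> \<le> real (card R) * ((\<epsilon> / (2 * real t)) ^ t * real n ^ t)"
        using cardR Suc.prems by (intro mult_right_mono) auto
      also have "\<dots> \<le> (\<Sum>K\<in>R. real (card {T \<in> \<T>. T \<subseteq> common_nbrs E S K}))"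
        using rich sum_bounded_below[of R "(\<epsilon> / (2 * real t)) ^ t * real n ^ t"] by auto
      also have "\<dots> = (\<Sum>T\<in>\<T>. real (card {K \<in> R. T \<subseteq> common_nbrs E S K}))"
      proof -
        have "(\<Sum>K\<in>R. real (card {T \<in> \<T>. T \<subseteq> common_nbrs E S K})) = (\<Sum>K\<in>R. \<Sum>T\<in>\<T>. of_bool (T \<subseteq> common_nbrs E S K))"
          using fin\<T> by (simp add: sum_of_bool_eq Int_def)
        also have "\<dots> = (\<Sum>T\<in>\<T>. \<Sum>K\<in>R. of_bool (T \<subseteq> common_nbrs E S K))" by (rule sum.swap)
        finally show ?thesis using finR by (simp add: sum_of_bool_eq Int_def)
      qed
      finally have total: "\<epsilon>' * real n ^ s * real n ^ t \<le> (\<Sum>T\<in>\<T>. real (card {K \<in> R. T \<subseteq> common_nbrs E S K}))" .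
      have "\<exists>T\<in>\<T>. \<epsilon>' * real n ^ s \<le> real (card {K \<in> R. T \<subseteq> common_nbrs E S K})"
      proof (rule ccontr)
        assume neg: "\<not> ?thesis"
        have "0 < \<epsilon>' * real n ^ s * real n ^ t" using \<open>\<epsilon>' > 0\<close> npos by simp
        then have "\<T> \<noteq> {}" using total by auto
        then have "(\<Sum>T\<in>\<T>. real (card {K \<in> R. T \<subseteq> common_nbrs E S K})) < (\<Sum>T\<in>\<T>. \<epsilon>' * real n ^ s)"
          using neg fin\<T> by (intro sum_strict_mono) auto
        also have "\<dots> = real (card \<T>) * (\<epsilon>' * real n ^ s)" by simp
        also have "\<dots> \<le> real n ^ t * (\<epsilon>' * real n ^ s)"
          using subsets_le[of t] \<open>\<epsilon>' > 0\<close>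
          by (intro mult_right_mono) (auto simp: \<T>_def of_nat_power[symmetric] simp del: of_nat_power)
        finally show False using total by (simp add: mult_ac)
      qed
      then obtain T where T: "T \<subseteq> S" "card T = t" "\<epsilon>' * real n ^ s \<le> real (card {K \<in> R. T \<subseteq> common_nbrs E S K})"
        by (auto simp: \<T>_def)
      have "{K \<in> R. T \<subseteq> common_nbrs E S K} \<subseteq> cliques E (common_nbrs E S T) s"
      proof
        fix K assume K: "K \<in> {K \<in> R. T \<subseteq> common_nbrs E S K}"
        have "K \<subseteq> common_nbrs E S T"
        proof
          fix w assume w: "w \<in> K"
          have "{u, w} \<in> E" if "u \<in> T" for u
          proof -
            have "u \<in> common_nbrs E S K" using that K by blast
            then have "{w, u} \<in> E" using w by (simp add: common_nbrs_def)
            then show ?thesis by (simp add: insert_commute)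
          qed
          moreover have "w \<in> S" using K w by (auto simp: R_def cliques_def)
          ultimately show "w \<in> common_nbrs E S T" by (simp add: common_nbrs_def)
        qed
        with K show "K \<in> cliques E (common_nbrs E S T) s" by (simp add: R_def cliques_def)
      qed
      then have "card {K \<in> R. T \<subseteq> common_nbrs E S K} \<le> card (cliques E (common_nbrs E S T) s)"
        using S by (intro card_mono) auto
      with T have "\<epsilon>' * real n ^ s \<le> real (card (cliques E (common_nbrs E S T) s))" by linarith
      moreover have "card (common_nbrs E S T) \<le> n" using card_common_nbrs_le S le_trans by blast
      ultimately obtain P where P: "joined E s P" "\<forall>i<s. P i \<subseteq> common_nbrs E S T \<and> card (P i) = t"
        using n1[OF npos(2), of "common_nbrs E S T" E] S by auto
      have "joined E (Suc s) (P(s := T))"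
        unfolding joined_def
      proof (intro allI impI ballI)
        fix i j x y assume *: "i < Suc s" "j < Suc s" "i \<noteq> j" "x \<in> (P(s := T)) i" "y \<in> (P(s := T)) j"
        consider "i < s" "j < s" | "i = s" "j < s" | "i < s" "j = s" using * by linarith
        then show "{x, y} \<in> E"
        proof cases
          case 1
          then show ?thesis using * P(1) by (auto dest: joinedD)
        next
          case 2
          have "y \<in> P j" "P j \<subseteq> common_nbrs E S T" using 2 * P(2) by simp_all
          then have "y \<in> common_nbrs E S T" by blast
          then show ?thesis using * 2 by (auto simp: common_nbrs_def)
        next
          case 3
          have "x \<in> P i" "P i \<subseteq> common_nbrs E S T" using 3 * P(2) by simp_all
          then have "x \<in> common_nbrs E S T" by blast
          then show ?thesis using * 3 by (auto simp: common_nbrs_def insert_commute)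
        qed
      qed
      moreover have "\<forall>i<Suc s. (P(s := T)) i \<subseteq> S \<and> card ((P(s := T)) i) = t"
        using P(2) T by (auto simp: less_Suc_eq common_nbrs_def)
      ultimately show "\<exists>P. joined E (Suc s) P \<and> (\<forall>i<Suc s. P i \<subseteq> S \<and> card (P i) = t)" by blast
    qed
  qed
qed

text \<open>Choose the parts one after another. The at most \<open>rN\<close> vertices chosen before spoil at most \<open>rNq\<close>
candidates in the next set.\<close>

lemma greedy_joined_subfamily:
  fixes q :: real
  assumes "\<And>i. i < r \<Longrightarrow> finite (A i)"
    and "\<And>i. i < r \<Longrightarrow> real N + real r * real N * q \<le> real (card (A i))"
    and "\<And>i j x. i < r \<Longrightarrow> j < r \<Longrightarrow> i \<noteq> j \<Longrightarrow> x \<in> A i \<Longrightarrow> real (card {y \<in> A j. {x, y} \<notin> E}) \<le> q"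
    and "q \<ge> 0"
  shows "\<exists>P. joined E r P \<and> (\<forall>i<r. P i \<subseteq> A i \<and> card (P i) = N)"
proof -
  have "\<exists>P. joined E k P \<and> (\<forall>i<k. P i \<subseteq> A i \<and> card (P i) = N)" if "k \<le> r" for k
    using that
  proof (induction k)
    case 0
    then show ?case by (auto simp: joined_def)
  next
    case (Suc k)
    then obtain P where P: "joined E k P" "\<And>i. i < k \<Longrightarrow> P i \<subseteq> A i" "\<And>i. i < k \<Longrightarrow> card (P i) = N" by auto
    define Bad where "Bad = (\<Union>i<k. \<Union>x\<in>P i. {y \<in> A k. {x, y} \<notin> E})"
    have finP: "finite (P i)" if "i < k" for i
      using P(2)[OF that] assms(1)[of i] that Suc.prems by (auto intro: finite_subset)
    have "card Bad \<le> (\<Sum>i<k. \<Sum>x\<in>P i. card {y \<in> A k. {x, y} \<notin> E})"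
      unfolding Bad_def using finP
      by (intro order_trans[OF card_UN_le] sum_mono card_UN_le) auto
    then have "real (card Bad) \<le> (\<Sum>i<k. \<Sum>x\<in>P i. real (card {y \<in> A k. {x, y} \<notin> E}))"
      by (simp only: of_nat_le_iff of_nat_sum[symmetric])
    also have "\<dots> \<le> (\<Sum>i<k. \<Sum>x\<in>P i. q)"
      using P(2) Suc.prems by (intro sum_mono assms(3)) auto
    also have "\<dots> = real k * real N * q" using P(3) by simp
    also have "\<dots> \<le> real r * real N * q" using Suc.prems assms(4) by (intro mult_right_mono) auto
    finally have "real N + real (card Bad) \<le> real (card (A k))" using assms(2)[of k] Suc.prems by simp
    moreover have "card (A k) - card Bad \<le> card (A k - Bad)"
      by (rule diff_card_le_card_Diff) (auto simp: Bad_def intro!: finite_subset[OF _ assms(1)[of k]] simp: Suc.prems less_eq_Suc_le)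
    ultimately have "N \<le> card (A k - Bad)" by linarith
    then obtain T where T: "T \<subseteq> A k - Bad" "card T = N" by (meson obtain_subset_with_card_n)
    have "joined E (Suc k) (P(k := T))"
      unfolding joined_def
    proof (intro allI impI ballI)
      fix i j x y assume *: "i < Suc k" "j < Suc k" "i \<noteq> j" "x \<in> (P(k := T)) i" "y \<in> (P(k := T)) j"
      have good: "{u, w} \<in> E" if "l < k" "u \<in> P l" "w \<in> T" for l u w
        using that T by (auto simp: Bad_def)
      consider "i < k" "j < k" | "i = k" "j < k" | "i < k" "j = k" using * by linarith
      then show "{x, y} \<in> E"
        using * P(1) good[of j y x] good[of i x y] by cases (auto simp: insert_commute dest: joinedD)
    qed
    moreover have "\<forall>i<Suc k. (P(k := T)) i \<subseteq> A i \<and> card ((P(k := T)) i) = N"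
      using P T by (auto simp: less_Suc_eq)
    ultimately show ?case by blast
  qed
  then show ?thesis by simp
qed

section \<open>Large minimum degree forces a colouring\<close>

text \<open>A vertex has fewer than \<open>N\<close> neighbours in some part, so at most \<open>(r - 1)T + N\<close> in the whole blow-up. By the
degree condition the average is almost as large, so all but few vertices see nearly everything outside
one part, which serves as their colour. Two adjacent vertices of the same colour have many common
neighbours in each of the other parts, contradicting \<open>no_edge_in_part\<close>.\<close>

lemma blowup_gives_almost_colouring:
  fixes \<epsilon> :: real
  assumes free: "plus_edge_free E S r N" and S: "finite S" "loopfree E" and pos: "N > 0" "r > 0"
    and P: "joined E r P" "\<And>i. i < r \<Longrightarrow> P i \<subseteq> S \<and> card (P i) = T"
    and T: "real N \<le> \<epsilon> * real T" "6 * N \<le> T"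
    and deg: "\<And>v. v \<in> S \<Longrightarrow> (1 - 1 / real r - \<epsilon>) * real (card S) \<le> real (deg E S v)"
  shows "\<exists>c :: 'v \<Rightarrow> nat. \<exists>B\<subseteq>S. real (card B) \<le> 4 * (real r + 1) * \<epsilon> * real (card S) \<and>
      (\<forall>v\<in>S - B. c v < r) \<and> (\<forall>u\<in>S - B. \<forall>v\<in>S - B. {u, v} \<in> E \<longrightarrow> c u \<noteq> c v)"
proof -
  define n where "n = real (card S)"
  have Tpos: "real T > 0" using T pos by linarith
  have finP: "finite (P i)" if "i < r" for i using P(2)[OF that] S finite_subset by blast
  define c where "c v = (SOME i. i < r \<and> card (common_nbrs E S {v} \<inter> P i) < N)" for v
  have c: "c v < r \<and> card (common_nbrs E S {v} \<inter> P (c v)) < N" if "v \<in> S" for v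
  proof -
    have "\<exists>i<r. card (common_nbrs E S {v} \<inter> P i) < N"
      using few_neighbours_in_some_part[OF free S(1) P(1) _ that pos] P(2) by blast
    then show ?thesis unfolding c_def by (rule someI_ex)
  qed
  define h where "h v = (\<Sum>i<r. real (card (common_nbrs E S {v} \<inter> P i)))" for v
  have le_T: "card (common_nbrs E S {v} \<inter> P i) \<le> T" if "i < r" for i v
    using card_mono[of "P i" "common_nbrs E S {v} \<inter> P i"] finP that P(2) by auto
  have h_split: "h v \<le> real N + (real r - 2) * real T + real (card (common_nbrs E S {v} \<inter> P j))"
    if "v \<in> S" "j < r" "j \<noteq> c v" for v j
  proof -
    have "h v = real (card (common_nbrs E S {v} \<inter> P (c v))) + (real (card (common_nbrs E S {v} \<inter> P j))
        + (\<Sum>i\<in>{..<r} - {c v} - {j}. real (card (common_nbrs E S {v} \<inter> P i))))"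
      unfolding h_def using c[OF that(1)] that by (simp add: sum.remove[of _ "c v"] sum.remove[of _ j])
    moreover have "(\<Sum>i\<in>{..<r} - {c v} - {j}. real (card (common_nbrs E S {v} \<inter> P i))) \<le> (\<Sum>i\<in>{..<r} - {c v} - {j}. real T)"
      using le_T by (intro sum_mono) auto
    moreover have "real (card ({..<r} - {c v} - {j})) = real r - 2"
      using c[OF that(1)] that by (simp add: card_Diff_subset of_nat_diff)
    ultimately show ?thesis using c[OF that(1)] by simp
  qed
  have h_le: "h v \<le> real N + (real r - 1) * real T" if "v \<in> S" for v
  proof -
    have "h v = real (card (common_nbrs E S {v} \<inter> P (c v))) + (\<Sum>i\<in>{..<r} - {c v}. real (card (common_nbrs E S {v} \<inter> P i)))"
      unfolding h_def using c[OF that(1)] by (simp add: sum.remove[of _ "c v"])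
    moreover have "(\<Sum>i\<in>{..<r} - {c v}. real (card (common_nbrs E S {v} \<inter> P i))) \<le> (\<Sum>i\<in>{..<r} - {c v}. real T)"
      using le_T by (intro sum_mono) auto
    moreover have "real (card ({..<r} - {c v})) = real r - 1"
      using c[OF that(1)] by (simp add: of_nat_diff)
    ultimately show ?thesis using c[OF that(1)] by simp
  qed
  \<comment> \<open>\<open>B\<close> collects the vertices that see noticeably less than \<open>r - 1\<close> parts.\<close>
  define B where "B = {v \<in> S. h v < (real r - 1) * real T - real T / 4}"
  have finB: "finite B" using S by (simp add: B_def)
  have "(\<Sum>v\<in>S. h v) = (\<Sum>i<r. \<Sum>x\<in>P i. real (deg E S x))"
  proof -
    have "(\<Sum>v\<in>S. h v) = (\<Sum>i<r. \<Sum>v\<in>S. real (card (common_nbrs E S {v} \<inter> P i)))"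
      unfolding h_def by (rule sum.swap)
    also have "\<dots> = (\<Sum>i<r. \<Sum>x\<in>P i. real (deg E S x))"
    proof (rule sum.cong)
      fix i assume "i \<in> {..<r}"
      then have i: "P i \<subseteq> S" "finite (P i)" using P(2) finP by auto
      have "(\<Sum>v\<in>S. real (card (common_nbrs E S {v} \<inter> P i))) = (\<Sum>v\<in>S. \<Sum>x\<in>P i. of_bool ({v, x} \<in> E))"
      proof (rule sum.cong)
        fix v
        have "common_nbrs E S {v} \<inter> P i = {x \<in> P i. {v, x} \<in> E}" using i by (auto simp: common_nbrs_def)
        then show "real (card (common_nbrs E S {v} \<inter> P i)) = (\<Sum>x\<in>P i. of_bool ({v, x} \<in> E))"
          using i by (simp add: sum_of_bool_eq Int_def)
      qed simp
      also have "\<dots> = (\<Sum>x\<in>P i. \<Sum>v\<in>S. of_bool ({v, x} \<in> E))" by (rule sum.swap)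
      also have "\<dots> = (\<Sum>x\<in>P i. real (deg E S x))"
        using S by (simp add: sum_of_bool_eq Int_def common_nbrs_def insert_commute)
      finally show "(\<Sum>v\<in>S. real (card (common_nbrs E S {v} \<inter> P i))) = (\<Sum>x\<in>P i. real (deg E S x))" .
    qed simp
    finally show ?thesis .
  qed
  also have "\<dots> \<ge> (\<Sum>i<r. \<Sum>x\<in>P i. (1 - 1 / real r - \<epsilon>) * n)"
    using deg P(2) unfolding n_def by (intro sum_mono) auto
  also have "(\<Sum>i<r. \<Sum>x\<in>P i. (1 - 1 / real r - \<epsilon>) * n) = (real r - 1 - real r * \<epsilon>) * real T * n"
    using P(2) pos by (simp add: field_simps)
  finally have low: "(real r - 1 - real r * \<epsilon>) * real T * n \<le> (\<Sum>v\<in>S. h v)" .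
  have "(\<Sum>v\<in>S. h v) \<le> (\<Sum>v\<in>S. real N + (real r - 1) * real T - real T / 4 * of_bool (v \<in> B))"
  proof (rule sum_mono)
    fix v assume "v \<in> S"
    then show "h v \<le> real N + (real r - 1) * real T - real T / 4 * of_bool (v \<in> B)"
      using h_le[of v] by (auto simp: B_def)
  qed
  also have "\<dots> = n * (real N + (real r - 1) * real T) - real T / 4 * real (card B)"
  proof -
    have "(\<Sum>v\<in>S. of_bool (v \<in> B)) = real (card B)"
      using S by (simp add: sum_of_bool_eq Int_def B_def)
    then show ?thesis by (simp only: sum_subtractf sum_distrib_left[symmetric]) (simp add: n_def)
  qed
  finally have "real T / 4 * real (card B) \<le> n * (real N + real r * \<epsilon> * real T)"
    using low by (simp add: algebra_simps)
  also have "\<dots> \<le> n * (\<epsilon> * real T + real r * \<epsilon> * real T)"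
    using T by (intro mult_left_mono) (auto simp: n_def)
  finally have "real T * real (card B) \<le> real T * (4 * (real r + 1) * \<epsilon> * n)"
    by (simp add: algebra_simps)
  then have cardB: "real (card B) \<le> 4 * (real r + 1) * \<epsilon> * n" using Tpos by simp
  have "c u \<noteq> c v" if uv: "u \<in> S - B" "v \<in> S - B" "{u, v} \<in> E" for u v
  proof
    assume same: "c u = c v"
    have big: "3 / 4 * real T - real N \<le> real (card (common_nbrs E S {w} \<inter> P j))"
      if "w = u \<or> w = v" "j < r" "j \<noteq> c u" for w j
    proof -
      have "w \<in> S" "(real r - 1) * real T - real T / 4 \<le> h w" using that uv by (auto simp: B_def)
      then show ?thesis using h_split[of w j] that same by (auto simp: algebra_simps)
    qed
    have "{u, v} \<notin> E"
    proof (rule no_edge_in_part[OF free S(1), of "\<lambda>j. if j = c u then P j else common_nbrs E S {u} \<inter> common_nbrs E S {v} \<inter> P j" "c u"])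
      show "joined E r (\<lambda>j. if j = c u then P j else common_nbrs E S {u} \<inter> common_nbrs E S {v} \<inter> P j)"
        using P(1) unfolding joined_def by auto
      fix j assume j: "j < r"
      show "(if j = c u then P j else common_nbrs E S {u} \<inter> common_nbrs E S {v} \<inter> P j) \<subseteq> S \<and>
            N \<le> card (if j = c u then P j else common_nbrs E S {u} \<inter> common_nbrs E S {v} \<inter> P j)"
      proof (cases "j = c u")
        case True
        then show ?thesis using P(2)[OF j] T by auto
      next
        case False
        define X Y where "X = common_nbrs E S {u} \<inter> P j" and "Y = common_nbrs E S {v} \<inter> P j"
        have XY: "finite X" "finite Y" "X \<union> Y \<subseteq> P j" using finP[OF j] by (auto simp: X_def Y_def)
        have XY_eq: "X \<inter> Y = common_nbrs E S {u} \<inter> common_nbrs E S {v} \<inter> P j" by (auto simp: X_def Y_def)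
        have "real (card (X \<union> Y)) \<le> real T"
          using XY card_mono[OF finP[OF j], of "X \<union> Y"] P(2)[OF j] by auto
        moreover have "real (card X) + real (card Y) = real (card (X \<union> Y)) + real (card (X \<inter> Y))"
          using XY card_Un_Int[of X Y] by linarith
        moreover have "3 / 4 * real T - real N \<le> real (card X)" "3 / 4 * real T - real N \<le> real (card Y)"
          using big[of u j] big[of v j] j False by (auto simp: X_def Y_def)
        moreover have "6 * real N \<le> real T" using T(2) by linarith
        ultimately have "real N \<le> real (card (X \<inter> Y))"
          by linarith
        then have "N \<le> card (common_nbrs E S {u} \<inter> common_nbrs E S {v} \<inter> P j)"
          using XY_eq by simp
        then show ?thesis using False P(2)[OF j] by auto
      qed
    qed (use uv c in auto)
    then show False using uv by simp
  qed
  then show ?thesis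
    using cardB c by (intro exI[of _ c] exI[of _ B]) (auto simp: n_def B_def)
qed

text \<open>Here \<open>a\<close> bounds the class sizes from below and \<open>b\<close> bounds the number of vertices not adjacent to a given
vertex from above. A vertex with at most \<open>\<theta>\<close> neighbours in its class \<open>V i\<close> spends almost all of the
nonadjacency budget \<open>b\<close> there, so it misses at most \<open>b - a + \<theta>\<close> vertices of any other class. A vertex
with more than \<open>\<theta>\<close> neighbours in every class would see a joined family chosen greedily among them; hence
each vertex of \<open>S\<close> has a class with few neighbours, and choosing one is a proper colouring.\<close>

lemma almost_colouring_extends:
  fixes a b \<theta> :: real
  assumes free: "plus_edge_free E S r N" and S: "finite S" and pos: "N > 0" "r > 0"
    and V: "\<And>i. i < r \<Longrightarrow> V i \<subseteq> S" "\<And>i. i < r \<Longrightarrow> a \<le> real (card (V i))"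
    and disj: "\<And>i j. i < r \<Longrightarrow> j < r \<Longrightarrow> i \<noteq> j \<Longrightarrow> V i \<inter> V j = {}"
    and indep: "\<And>i u v. i < r \<Longrightarrow> u \<in> V i \<Longrightarrow> v \<in> V i \<Longrightarrow> {u, v} \<notin> E"
    and deg: "\<And>v. v \<in> S \<Longrightarrow> real (card S) - b \<le> real (deg E S v)"
    and ab: "a \<le> b" and \<theta>: "\<theta> \<ge> 0"
    and H1: "real N + real r * real N * (b - a) \<le> \<theta>"
    and H2: "real N + real r * real N * (b - a) \<le> a - 2 * (b - a + \<theta>)"
  shows "\<exists>c :: 'v \<Rightarrow> nat. (\<forall>v\<in>S. c v < r) \<and> (\<forall>u\<in>S. \<forall>v\<in>S. {u, v} \<in> E \<longrightarrow> c u \<noteq> c v)"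
proof -
  have finV: "finite (V i)" if "i < r" for i using V S that finite_subset by blast
  have missed: "real (card {y \<in> V j. {v, y} \<notin> E}) \<le> b - a + real (card (common_nbrs E S {v} \<inter> V i))"
    if "v \<in> S" "i < r" "j < r" "i \<noteq> j" for v i j
  proof -
    define X Y Z where "X = common_nbrs E S {v}" and "Y = {y \<in> V j. {v, y} \<notin> E}" and "Z = {y \<in> V i. {v, y} \<notin> E}"
    have fin: "finite X" "finite Y" "finite Z" using S finV that by (auto simp: X_def Y_def Z_def)
    have "card (X \<union> Y \<union> Z) = card X + card Y + card Z"
      using fin disj[OF that(2-4)] by (subst card_Un_disjoint; (subst card_Un_disjoint)?)
         (auto simp: X_def Y_def Z_def common_nbrs_def)
    moreover have "card (X \<union> Y \<union> Z) \<le> card S"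
      using S V that by (intro card_mono) (auto simp: X_def Y_def Z_def common_nbrs_def)
    moreover have "card (V i) = card (X \<inter> V i) + card Z"
    proof -
      have "V i = (X \<inter> V i) \<union> Z" using V that by (auto simp: X_def Z_def common_nbrs_def)
      then have "card (V i) = card ((X \<inter> V i) \<union> Z)" by simp
      also have "\<dots> = card (X \<inter> V i) + card Z"
        using fin by (intro card_Un_disjoint) (auto simp: X_def Z_def common_nbrs_def)
      finally show ?thesis .
    qed
    ultimately show ?thesis
      using deg[OF that(1)] V(2)[OF that(2)] unfolding X_def[symmetric] Y_def[symmetric] by linarith
  qed
  have missed_in: "real (card {y \<in> V j. {v, y} \<notin> E}) \<le> b - a"
    if "i < r" "j < r" "i \<noteq> j" "v \<in> V i" for v i j
  proof -
    have "common_nbrs E S {v} \<inter> V i = {}" using indep[of i v] that by (auto simp: common_nbrs_def)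
    then show ?thesis using missed[of v i j] that V by auto
  qed
  have "\<exists>i<r. real (card (common_nbrs E S {v} \<inter> V i)) \<le> \<theta>" if v: "v \<in> S" for v
  proof (rule ccontr)
    assume neg: "\<not> ?thesis"
    have "\<exists>P. joined E r P \<and> (\<forall>i<r. P i \<subseteq> common_nbrs E S {v} \<inter> V i \<and> card (P i) = N)"
    proof (rule greedy_joined_subfamily[where q = "b - a"])
      show "real N + real r * real N * (b - a) \<le> real (card (common_nbrs E S {v} \<inter> V i))" if "i < r" for i
        using neg H1 that by force
      show "real (card {y \<in> common_nbrs E S {v} \<inter> V j. {x, y} \<notin> E}) \<le> b - a"
        if "i < r" "j < r" "i \<noteq> j" "x \<in> common_nbrs E S {v} \<inter> V i" for i j x
      proof -
        have "card {y \<in> common_nbrs E S {v} \<inter> V j. {x, y} \<notin> E} \<le> card {y \<in> V j. {x, y} \<notin> E}"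
          using finV that by (intro card_mono) auto
        then show ?thesis using missed_in[of i j x] that by auto
      qed
    qed (use finV ab in auto)
    then obtain P where P: "joined E r P" "\<And>i. i < r \<Longrightarrow> P i \<subseteq> common_nbrs E S {v} \<inter> V i" "\<And>i. i < r \<Longrightarrow> card (P i) = N"
      by blast
    have "\<exists>i<r. card (common_nbrs E S {v} \<inter> P i) < N"
      using P V by (intro few_neighbours_in_some_part[OF free S P(1) _ v pos]) blast
    then obtain i where i: "i < r" "card (common_nbrs E S {v} \<inter> P i) < N" by blast
    moreover have "common_nbrs E S {v} \<inter> P i = P i" using P(2)[OF i(1)] by blast
    ultimately show False using P(3) by simp
  qed
  then obtain c where c: "\<And>v. v \<in> S \<Longrightarrow> c v < r \<and> real (card (common_nbrs E S {v} \<inter> V (c v))) \<le> \<theta>" by metis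
  have "c u \<noteq> c v" if uv: "u \<in> S" "v \<in> S" "{u, v} \<in> E" for u v
  proof
    assume same: "c u = c v"
    define A where "A j = (if j = c u then V j else common_nbrs E S {u} \<inter> common_nbrs E S {v} \<inter> V j)" for j
    have A_sub: "A j \<subseteq> V j" for j by (auto simp: A_def)
    have "\<exists>P. joined E r P \<and> (\<forall>i<r. P i \<subseteq> A i \<and> card (P i) = N)"
    proof (rule greedy_joined_subfamily[where q = "b - a"])
      fix i assume i: "i < r"
      show "finite (A i)" using A_sub finV[OF i] by (rule finite_subset)
      show "real N + real r * real N * (b - a) \<le> real (card (A i))"
      proof (cases "i = c u")
        case True
        have "a - 2 * (b - a + \<theta>) \<le> a" using ab \<theta> by simp
        with H2 have "real N + real r * real N * (b - a) \<le> a" by (rule order_trans)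
        then show ?thesis using True V(2)[OF i] by (simp add: A_def)
      next
        case False
        have miss: "real (card {y \<in> V i. {w, y} \<notin> E}) \<le> b - a + \<theta>" if "w = u \<or> w = v" for w
        proof -
          have w: "w \<in> S" "c w = c u" using that uv same by auto
          show ?thesis using missed[OF w(1), of "c u" i] c[OF w(1)] w(2) i False by auto
        qed
        have "card (V i) \<le> card (A i \<union> ({y \<in> V i. {u, y} \<notin> E} \<union> {y \<in> V i. {v, y} \<notin> E}))"
          using finV[OF i] V(1)[OF i] False by (intro card_mono) (auto simp: A_def common_nbrs_def)
        also have "\<dots> \<le> card (A i) + (card {y \<in> V i. {u, y} \<notin> E} + card {y \<in> V i. {v, y} \<notin> E})"
          by (meson card_Un_le add_left_mono le_trans)
        finally show ?thesis using miss[of u] miss[of v] V(2)[OF i] H2 by auto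
      qed
    next
      fix i j x assume *: "i < r" "j < r" "i \<noteq> j" "x \<in> A i"
      have "card {y \<in> A j. {x, y} \<notin> E} \<le> card {y \<in> V j. {x, y} \<notin> E}"
        using finV * A_sub by (intro card_mono) auto
      then show "real (card {y \<in> A j. {x, y} \<notin> E}) \<le> b - a"
        using missed_in[of i j x] * A_sub by fastforce
    qed (use ab in auto)
    then obtain P where P: "joined E r P" "\<And>i. i < r \<Longrightarrow> P i \<subseteq> A i" "\<And>i. i < r \<Longrightarrow> card (P i) = N"
      by blast
    have "{u, v} \<notin> E"
    proof (rule no_edge_in_part[OF free S P(1), of "c u"])
      show "P j \<subseteq> S \<and> N \<le> card (P j)" if "j < r" for j
        using P(2,3)[OF that] A_sub[of j] V(1)[OF that] by auto
      show "P j \<subseteq> common_nbrs E S {u} \<inter> common_nbrs E S {v}" if "j < r" "j \<noteq> c u" for j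
        using P(2)[OF that(1)] that by (auto simp: A_def)
    qed (use uv c in auto)
    then show False using uv by simp
  qed
  then show ?thesis using c by blast
qed

text \<open>A clique with fewer than \<open>r\<close> vertices has at least \<open>n - (r - 1)(1/r + \<epsilon>)n \<ge> n/(2r)\<close> common neighbours.\<close>

lemma min_degree_many_cliques:
  fixes \<epsilon> :: real
  assumes S: "finite S" "loopfree E" and r: "r > 0" "s \<le> r" and \<epsilon>: "\<epsilon> * (2 * (real r)\<^sup>2) \<le> 1" "\<epsilon> \<ge> 0"
    and deg: "\<And>v. v \<in> S \<Longrightarrow> (1 - 1 / real r - \<epsilon>) * real (card S) \<le> real (deg E S v)"
  shows "(1 / (2 * (real r)\<^sup>2)) ^ s * real (card S) ^ s \<le> real (card (cliques E S s))"
  using r(2)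
proof (induction s)
  case 0
  have "cliques E S 0 = {{}}" using S by (auto simp: cliques_def dest: finite_subset)
  then show ?case by simp
next
  case (Suc s)
  define n where "n = real (card S)"
  have n: "n \<ge> 0" by (simp add: n_def)
  have ext: "n / (2 * real r) \<le> real (card (common_nbrs E S K))" if K: "K \<in> cliques E S s" for K
  proof -
    have KS: "K \<subseteq> S" "finite K" "card K = s" using K finite_clique[OF S(1) K] by (auto simp: cliques_def)
    have "S - common_nbrs E S K \<subseteq> (\<Union>u\<in>K. S - common_nbrs E S {u})" by (auto simp: common_nbrs_def)
    then have "card (S - common_nbrs E S K) \<le> card (\<Union>u\<in>K. S - common_nbrs E S {u})"
      using S KS by (intro card_mono) auto
    also have "\<dots> \<le> (\<Sum>u\<in>K. card (S - common_nbrs E S {u}))" using KS by (intro card_UN_le)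
    finally have "real (card (S - common_nbrs E S K)) \<le> (\<Sum>u\<in>K. real (card (S - common_nbrs E S {u})))"
      by (simp only: of_nat_le_iff of_nat_sum[symmetric])
    also have "\<dots> \<le> (\<Sum>u\<in>K. (1 / real r + \<epsilon>) * n)"
    proof (rule sum_mono)
      fix u assume "u \<in> K"
      then have "u \<in> S" using KS by blast
      moreover have "card (S - common_nbrs E S {u}) = card S - deg E S u" "deg E S u \<le> card S"
        using S by (auto simp: common_nbrs_def intro!: card_Diff_subset card_mono)
      ultimately show "real (card (S - common_nbrs E S {u})) \<le> (1 / real r + \<epsilon>) * n"
        using deg[of u] by (simp add: n_def of_nat_diff algebra_simps)
    qed
    also have "\<dots> = real s * ((1 / real r + \<epsilon>) * n)" using KS by simp
    also have "\<dots> \<le> (real r - 1) * ((1 / real r + \<epsilon>) * n)"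
      using Suc.prems \<epsilon> n by (intro mult_right_mono) auto
    also have "\<dots> \<le> (1 - 1 / (2 * real r)) * n"
    proof -
      have "(real r - 1) * \<epsilon> \<le> real r * \<epsilon>" using \<epsilon> by (intro mult_right_mono) auto
      also have "\<dots> \<le> 1 / (2 * real r)" using \<epsilon> r by (simp add: field_simps power2_eq_square)
      moreover have "(real r - 1) * (1 / real r + \<epsilon>) = 1 - 2 * (1 / (2 * real r)) + (real r - 1) * \<epsilon>"
        using r by (simp add: field_simps)
      ultimately have "(real r - 1) * (1 / real r + \<epsilon>) \<le> 1 - 1 / (2 * real r)" by linarith
      from mult_right_mono[OF this n] show ?thesis by (simp add: mult.assoc)
    qed
    finally have "real (card (S - common_nbrs E S K)) \<le> (1 - 1 / (2 * real r)) * n" .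
    moreover have "card (S - common_nbrs E S K) = card S - card (common_nbrs E S K)" "card (common_nbrs E S K) \<le> card S"
      using S by (auto simp: common_nbrs_def intro!: card_Diff_subset card_mono)
    ultimately show ?thesis by (simp add: n_def of_nat_diff algebra_simps)
  qed
  have "real (card (cliques E S s)) * (n / (2 * real r)) \<le> (\<Sum>K\<in>cliques E S s. real (card (common_nbrs E S K)))"
    using ext sum_bounded_below[of "cliques E S s" "n / (2 * real r)" "\<lambda>K. real (card (common_nbrs E S K))"] by simp
  also have "\<dots> = real (Suc s) * real (card (cliques E S (Suc s)))" by (rule sum_card_common_nbrs[OF S])
  also have "\<dots> \<le> real r * real (card (cliques E S (Suc s)))"
    using Suc.prems by (intro mult_right_mono) auto
  finally have step: "real (card (cliques E S s)) * n / (2 * (real r)\<^sup>2) \<le> real (card (cliques E S (Suc s)))"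
    using r by (simp add: field_simps power2_eq_square)
  have "(1 / (2 * (real r)\<^sup>2)) ^ Suc s * n ^ Suc s = ((1 / (2 * (real r)\<^sup>2)) ^ s * n ^ s) * (n / (2 * (real r)\<^sup>2))"
    by simp
  also have "\<dots> \<le> real (card (cliques E S s)) * (n / (2 * (real r)\<^sup>2))"
    using Suc n unfolding n_def by (intro mult_right_mono) auto
  finally show ?case using step by (simp add: n_def)
qed

text \<open>A theorem of Andrasfai--Erdos--Sos type. The minimum degree produces many cliques of size \<open>r\<close>, hence a
large blow-up, hence a colouring of all but \<open>O(\<epsilon>n)\<close> vertices, whose classes are independent and therefore
have size close to \<open>n/r\<close>; that colouring is then extended to all vertices.\<close>

lemma min_degree_forces_colouring:
  assumes pos: "N > 0" "r > 0"
  shows "\<exists>\<epsilon>0>0. \<forall>\<epsilon>. 0 < \<epsilon> \<and> \<epsilon> \<le> \<epsilon>0 \<longrightarrow> (\<exists>n0. \<forall>E (S :: 'v set). finite S \<longrightarrow> loopfree E \<longrightarrow> n0 \<le> card S \<longrightarrow>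
     plus_edge_free E S r N \<longrightarrow> (\<forall>v\<in>S. (1 - 1 / real r - \<epsilon>) * real (card S) \<le> real (deg E S v)) \<longrightarrow>
     (\<exists>c :: 'v \<Rightarrow> nat. (\<forall>v\<in>S. c v < r) \<and> (\<forall>u\<in>S. \<forall>v\<in>S. {u, v} \<in> E \<longrightarrow> c u \<noteq> c v)))"
proof -
  \<comment> \<open>The classes below satisfy \<open>b - a = \<mu>\<epsilon>n\<close>; \<open>\<epsilon>0\<close> makes \<open>(rN + 3)(b - a)\<close> at most \<open>n/(16r)\<close>.\<close>
  define \<mu> where "\<mu> = (5 * real r + 4)"
  define \<epsilon>0 where "\<epsilon>0 = 1 / (16 * real r * \<mu> * (real r * real N + 3))"
  have \<mu>: "\<mu> > 0" by (simp add: \<mu>_def)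
  have N3: "real r * real N + 3 > 0" by (simp add: add_nonneg_pos)
  have \<epsilon>0: "\<epsilon>0 > 0" "16 * real r * ((\<mu> * \<epsilon>0) * (real r * real N + 3)) = 1"
    using pos \<mu> N3 by (simp_all add: \<epsilon>0_def)
  show ?thesis
  proof (intro exI[of _ \<epsilon>0] conjI allI impI \<epsilon>0(1))
    fix \<epsilon> assume "0 < \<epsilon> \<and> \<epsilon> \<le> \<epsilon>0"
    then have \<epsilon>: "0 < \<epsilon>" "\<epsilon> \<le> \<epsilon>0" by auto
    have small: "16 * real r * ((\<mu> * \<epsilon>) * (real r * real N + 3)) \<le> 1"
    proof -
      have "(\<mu> * \<epsilon>) * (real r * real N + 3) \<le> (\<mu> * \<epsilon>0) * (real r * real N + 3)"
        using \<epsilon> \<mu> N3 by (intro mult_right_mono mult_left_mono) auto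
      then have "16 * real r * ((\<mu> * \<epsilon>) * (real r * real N + 3)) \<le> 16 * real r * ((\<mu> * \<epsilon>0) * (real r * real N + 3))"
        by (intro mult_left_mono) auto
      then show ?thesis using \<epsilon>0(2) by simp
    qed
    have \<epsilon>r: "\<epsilon> * (2 * (real r)\<^sup>2) \<le> 1"
    proof -
      have "real r * \<epsilon> \<le> (\<mu> * \<epsilon>) * (real r * real N + 3)"
      proof -
        have "real r * 1 \<le> \<mu> * (real r * real N + 3)"
          by (intro mult_mono) (auto simp: \<mu>_def)
        then have "real r * 1 * \<epsilon> \<le> \<mu> * (real r * real N + 3) * \<epsilon>"
          using \<epsilon> by (intro mult_right_mono) auto
        then show ?thesis by (simp add: mult_ac)
      qed
      then have "16 * real r * (real r * \<epsilon>) \<le> 1"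
        using small mult_left_mono[of "real r * \<epsilon>" "(\<mu> * \<epsilon>) * (real r * real N + 3)" "16 * real r"] by linarith
      moreover have "0 \<le> real r * (real r * \<epsilon>)" using \<epsilon> by simp
      ultimately show ?thesis by (simp add: power2_eq_square algebra_simps)
    qed
    define T where "T = max (6 * N) (nat \<lceil>real N / \<epsilon>\<rceil>)"
    have T: "6 * N \<le> T" "real N \<le> \<epsilon> * real T"
    proof -
      have "real N / \<epsilon> \<le> real T" unfolding T_def by linarith
      then show "real N \<le> \<epsilon> * real T" using \<epsilon> by (simp add: field_simps)
    qed (simp add: T_def)
    have "(1 / (2 * (real r)\<^sup>2)) ^ r > 0" using pos by simp
    from many_cliques_give_blowup[OF this, of r T] obtain n1 where n1:
      "\<And>n E (S :: 'v set). n1 \<le> n \<Longrightarrow> finite S \<Longrightarrow> loopfree E \<Longrightarrow> card S \<le> n \<Longrightarrow>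
        (1 / (2 * (real r)\<^sup>2)) ^ r * real n ^ r \<le> real (card (cliques E S r)) \<Longrightarrow>
        \<exists>P. joined E r P \<and> (\<forall>i<r. P i \<subseteq> S \<and> card (P i) = T)" by metis
    define n0 where "n0 = max n1 (16 * r * N)"
    show "\<exists>n0. \<forall>E (S :: 'v set). finite S \<longrightarrow> loopfree E \<longrightarrow> n0 \<le> card S \<longrightarrow>
     plus_edge_free E S r N \<longrightarrow> (\<forall>v\<in>S. (1 - 1 / real r - \<epsilon>) * real (card S) \<le> real (deg E S v)) \<longrightarrow>
     (\<exists>c :: 'v \<Rightarrow> nat. (\<forall>v\<in>S. c v < r) \<and> (\<forall>u\<in>S. \<forall>v\<in>S. {u, v} \<in> E \<longrightarrow> c u \<noteq> c v))"
    proof (intro exI[of _ n0] allI impI)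
      fix E and S :: "'v set"
      assume S: "finite S" "loopfree E" and large: "n0 \<le> card S" and free: "plus_edge_free E S r N"
        and deg': "\<forall>v\<in>S. (1 - 1 / real r - \<epsilon>) * real (card S) \<le> real (deg E S v)"
      define n where "n = real (card S)"
      have "real (16 * r * N) \<le> real (card S)" using large unfolding n0_def of_nat_le_iff by simp
      then have n: "n \<ge> 0" "16 * real r * real N \<le> n" by (simp_all add: n_def)
      from deg' have deg: "(1 - 1 / real r - \<epsilon>) * real (card S) \<le> real (deg E S v)" if "v \<in> S" for v
        using that by blast
      have "(1 / (2 * (real r)\<^sup>2)) ^ r * real (card S) ^ r \<le> real (card (cliques E S r))"
        using min_degree_many_cliques[OF S pos(2) _ \<epsilon>r _ deg] \<epsilon> by auto
      then obtain P where P: "joined E r P" "\<And>i. i < r \<Longrightarrow> P i \<subseteq> S \<and> card (P i) = T"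
        using n1[of "card S" S E] S large unfolding n0_def by auto
      obtain c B where B: "B \<subseteq> S" "real (card B) \<le> 4 * (real r + 1) * \<epsilon> * n"
        and c: "\<And>v. v \<in> S - B \<Longrightarrow> c v < r"
          "\<And>u v. u \<in> S - B \<Longrightarrow> v \<in> S - B \<Longrightarrow> {u, v} \<in> E \<Longrightarrow> c u \<noteq> (c v :: nat)"
        using blowup_gives_almost_colouring[OF free S pos P T(2,1) deg] unfolding n_def by metis
      define V where "V i = {v \<in> S - B. c v = i}" for i
      have V_le: "real (card (V i)) \<le> (1 / real r + \<epsilon>) * n" for i
      proof (cases "V i = {}")
        case True
        then show ?thesis using n \<epsilon> by simp
      next
        case False
        then obtain v where v: "v \<in> V i" by blast
        have "common_nbrs E S {v} \<subseteq> S - V i"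
        proof
          fix w assume "w \<in> common_nbrs E S {v}"
          then show "w \<in> S - V i" using c(2)[of v w] v by (auto simp: V_def common_nbrs_def)
        qed
        then have "deg E S v \<le> card (S - V i)" using S by (intro card_mono) auto
        also have "card (S - V i) = card S - card (V i)"
          using S by (intro card_Diff_subset) (auto simp: V_def intro: finite_subset)
        finally have "real (deg E S v) + real (card (V i)) \<le> n"
          using card_mono[of S "V i"] S by (auto simp: V_def n_def)
        then show ?thesis using deg[of v] v by (auto simp: V_def n_def algebra_simps)
      qed
      have "card (\<Union>i<r. V i) = (\<Sum>i<r. card (V i))"
        using S by (intro card_UN_disjoint) (auto simp: V_def)
      moreover have "(\<Union>i<r. V i) = S - B" using c(1) by (auto simp: V_def)
      moreover have "card (S - B) = card S - card B" "card B \<le> card S"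
        using S B by (auto intro: card_Diff_subset card_mono finite_subset)
      ultimately have sumV: "(\<Sum>i<r. real (card (V i))) = n - real (card B)"
        by (simp add: n_def of_nat_diff flip: of_nat_sum)
      define a b \<theta> where "a = (1 / real r - (5 * real r + 3) * \<epsilon>) * n" and "b = (1 / real r + \<epsilon>) * n"
        and "\<theta> = n / (8 * real r)"
      have ba: "b - a = \<mu> * \<epsilon> * n" by (simp add: a_def b_def \<mu>_def algebra_simps)
      have aV: "a \<le> real (card (V i))" if "i < r" for i
      proof -
        have "(\<Sum>i<r. real (card (V i))) = real (card (V i)) + (\<Sum>j\<in>{..<r} - {i}. real (card (V j)))"
          using that by (intro sum.remove) auto
        also have "(\<Sum>j\<in>{..<r} - {i}. real (card (V j))) \<le> (\<Sum>j\<in>{..<r} - {i}. (1 / real r + \<epsilon>) * n)"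
          using V_le by (intro sum_mono) auto
        also have "\<dots> = (real r - 1) * ((1 / real r + \<epsilon>) * n)" using that by (simp add: of_nat_diff)
        finally have "n - 4 * (real r + 1) * \<epsilon> * n - (real r - 1) * ((1 / real r + \<epsilon>) * n) \<le> real (card (V i))"
          using sumV B by simp
        also have "n - 4 * (real r + 1) * \<epsilon> * n - (real r - 1) * ((1 / real r + \<epsilon>) * n) = a"
          using pos by (simp add: a_def field_simps)
        finally show ?thesis .
      qed
      have key: "16 * real r * (\<mu> * \<epsilon> * n * (real r * real N + 3)) \<le> n"
        using mult_right_mono[OF small n(1)] by (simp add: mult_ac)
      \<comment> \<open>All quantities are compared in the unit \<open>x\<close>: \<open>b \<approx> 16x\<close>, \<open>\<theta> = 2x\<close>, \<open>N \<le> x\<close>.\<close>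
      define x where "x = n / (16 * real r)"
      have x: "x \<ge> 0" "real N \<le> x" "\<mu> * \<epsilon> * n * (real r * real N + 3) \<le> x"
        using n key pos unfolding x_def by (simp_all add: pos_le_divide_eq mult_ac)
      have "0 \<le> \<mu> * \<epsilon> * n" using \<epsilon> \<mu> n by simp
      then have x3: "0 \<le> b - a" "real r * real N * (b - a) + 3 * (b - a) \<le> x"
        using x(3) unfolding ba by (simp_all add: algebra_simps)
      then have "0 \<le> real r * real N * (b - a)" by (intro mult_nonneg_nonneg) auto
      note x3 = x3 this
      define D where "D = b - a"
      define L where "L = real r * real N * D"
      have LD: "0 \<le> D" "L + 3 * D \<le> x" "0 \<le> L" using x3 by (simp_all only: L_def D_def)
      have \<theta>x: "\<theta> = 2 * x" using pos by (simp add: \<theta>_def x_def)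
      have bx: "b = 16 * x + \<epsilon> * n" using pos by (simp add: b_def x_def field_simps)
      have "0 \<le> \<epsilon> * n" using \<epsilon> n by simp
      show "\<exists>c :: 'v \<Rightarrow> nat. (\<forall>v\<in>S. c v < r) \<and> (\<forall>u\<in>S. \<forall>v\<in>S. {u, v} \<in> E \<longrightarrow> c u \<noteq> c v)"
      proof (rule almost_colouring_extends[OF free S(1) pos, of V a b \<theta>])
        show "real (card S) - b \<le> real (deg E S v)" if "v \<in> S" for v
          using deg[OF that] by (simp add: b_def n_def algebra_simps)
        show "real N + real r * real N * (b - a) \<le> \<theta>"
          using x(1,2) LD \<theta>x unfolding D_def[symmetric] L_def[symmetric] by linarith
        have "16 * x - D \<le> a" using bx \<open>0 \<le> \<epsilon> * n\<close> by (simp add: D_def)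
        moreover have "real N + L \<le> 2 * x - 3 * D" using x(2) LD by linarith
        ultimately show "real N + real r * real N * (b - a) \<le> a - 2 * (b - a + \<theta>)"
          using x(1) unfolding D_def[symmetric] L_def[symmetric] \<theta>x by argo
        show "{u, v} \<notin> E" if "u \<in> V i" "v \<in> V i" for i u v
          using c(2)[of u v] that by (auto simp: V_def)
      qed (use aV x3 x in \<open>auto simp: V_def \<theta>x\<close>)
    qed
  qed
qed

section \<open>Stability: nonpositive gap concentrates the degrees\<close>

text \<open>The right-hand side minus the left-hand side of the inequality to be proved.\<close>

definition gap :: "nat \<Rightarrow> 'v set set \<Rightarrow> 'v set \<Rightarrow> real" where
  "gap r E S = 2 * (1 - 1 / real r) * real (card (cliques E S 2)) * real (card S)
     - (\<Sum>v\<in>S. (real (deg E S v))\<^sup>2)"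

lemma edge_degree_sum:
  assumes "finite S" "e \<in> cliques E S 2"
  shows "(\<Sum>u\<in>e. real (deg E S u)) + real (card (twice_missed E S e)) = real (card S) + real (card (common_nbrs E S e))"
proof -
  obtain u v where "e = {u, v}" "u \<noteq> v" using assms(2) by (auto simp: cliques_def card_2_iff)
  then have "(\<Sum>v\<in>e. real (card (common_nbrs E S (e - {v})))) = (\<Sum>u\<in>e. real (deg E S u))"
    by (auto simp: insert_Diff_if)
  then show ?thesis using clique_extension_count[OF assms] by simp
qed

text \<open>The sum of \<open>edge_degree_sum\<close> over all edges. For a nonpositive gap it bounds the number of triangles
from below and, once that number is bounded from above, the total defect from above.\<close>

lemma triangle_surplus:
  assumes "finite S" "loopfree E"
  shows "3 * real (card (cliques E S 3)) = (1 - 2 / real r) * real (card S) * real (card (cliques E S 2))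
    + (\<Sum>e\<in>cliques E S 2. real (card (twice_missed E S e))) - gap r E S"
proof -
  define n m where "n = real (card S)" and "m = real (card (cliques E S 2))"
  have "(\<Sum>v\<in>S. (real (deg E S v))\<^sup>2) = (\<Sum>e\<in>cliques E S 2. \<Sum>u\<in>e. real (deg E S u))"
    using sum_edges_ends[OF assms] by (simp add: power2_eq_square)
  also have "\<dots> + (\<Sum>e\<in>cliques E S 2. real (card (twice_missed E S e)))
      = (\<Sum>e\<in>cliques E S 2. n + real (card (common_nbrs E S e)))"
    unfolding sum.distrib[symmetric] n_def by (intro sum.cong edge_degree_sum[OF assms(1)]) auto
  also have "\<dots> = n * m + 3 * real (card (cliques E S 3))"
    using sum_card_common_nbrs[OF assms, of 2] by (simp add: sum.distrib m_def eval_nat_numeral)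
  finally show ?thesis by (simp add: gap_def n_def m_def algebra_simps)
qed

text \<open>The triangles at \<open>v\<close> are the edges inside its neighbourhood, of which there are at most \<open>d\<^sup>2\<close> and at most
\<open>m\<close>. The first bound is used for \<open>d \<le> n/12\<close>, the second for larger degrees \<open>d\<close>.\<close>

lemma triangles_le:
  assumes "finite S" "loopfree E"
  defines "m \<equiv> real (card (cliques E S 2))"
  shows "real (card S) * (3 * real (card (cliques E S 3))) \<le> m * (real (card S))\<^sup>2 / 6 + 24 * m\<^sup>2"
proof -
  define n where "n = real (card S)"
  define c where "c v = real (card {e \<in> cliques E S 2. v \<in> common_nbrs E S e})" for v
  have "3 * real (card (cliques E S 3)) = (\<Sum>e\<in>cliques E S 2. real (card (common_nbrs E S e)))"
    using sum_card_common_nbrs[OF assms(1,2), of 2] by (simp add: eval_nat_numeral)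
  also have "\<dots> = (\<Sum>e\<in>cliques E S 2. \<Sum>v\<in>S. of_bool (v \<in> common_nbrs E S e))"
    using assms(1) by (simp add: sum_of_bool_eq Int_def common_nbrs_def)
  also have "\<dots> = (\<Sum>v\<in>S. \<Sum>e\<in>cliques E S 2. of_bool (v \<in> common_nbrs E S e))" by (rule sum.swap)
  also have "\<dots> = (\<Sum>v\<in>S. c v)" using assms(1) by (simp add: c_def sum_of_bool_eq Int_def)
  finally have "n * (3 * real (card (cliques E S 3))) = (\<Sum>v\<in>S. n * c v)" by (simp add: sum_distrib_left)
  also have "\<dots> \<le> (\<Sum>v\<in>S. real (deg E S v) * (n\<^sup>2 / 12 + 12 * m))"
  proof (rule sum_mono)
    fix v assume "v \<in> S"
    define d where "d = real (deg E S v)"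
    have "c v \<le> m" unfolding c_def m_def using assms(1) by (auto intro: card_mono)
    have "{e \<in> cliques E S 2. v \<in> common_nbrs E S e} \<subseteq> {e. e \<subseteq> common_nbrs E S {v} \<and> card e = 2}"
      by (auto simp: cliques_def common_nbrs_def insert_commute)
    then have "card {e \<in> cliques E S 2. v \<in> common_nbrs E S e} \<le> card {e. e \<subseteq> common_nbrs E S {v} \<and> card e = 2}"
      using assms(1) by (intro card_mono) auto
    also have "\<dots> \<le> (deg E S v)\<^sup>2" using assms(1) by (intro card_subsets_le_power) simp
    finally have "c v \<le> d\<^sup>2" unfolding c_def d_def by (simp only: of_nat_le_iff of_nat_power[symmetric])
    have nonneg: "n \<ge> 0" "m \<ge> 0" "d \<ge> 0" by (simp_all add: n_def m_def d_def)
    show "n * c v \<le> d * (n\<^sup>2 / 12 + 12 * m)"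
    proof (cases "12 * d \<le> n")
      case True
      have "n * c v \<le> n * d\<^sup>2" using \<open>c v \<le> d\<^sup>2\<close> nonneg by (intro mult_left_mono)
      also have "\<dots> = (n * d) * d" by (simp add: power2_eq_square)
      also have "\<dots> \<le> (n * d) * (n / 12)" using True nonneg by (intro mult_left_mono) auto
      also have "\<dots> \<le> d * (n\<^sup>2 / 12 + 12 * m)" using nonneg by (simp add: power2_eq_square algebra_simps)
      finally show ?thesis .
    next
      case False
      have "n * c v \<le> n * m" using \<open>c v \<le> m\<close> nonneg by (intro mult_left_mono)
      also have "\<dots> \<le> (12 * d) * m" using False nonneg by (intro mult_right_mono) auto
      also have "\<dots> \<le> d * (n\<^sup>2 / 12 + 12 * m)" using nonneg by (simp add: algebra_simps)
      finally show ?thesis .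
    qed
  qed
  also have "\<dots> = 2 * m * (n\<^sup>2 / 12 + 12 * m)"
    using sum_deg[OF assms(1,2)] by (simp add: sum_distrib_right[symmetric] m_def)
  finally show ?thesis by (simp add: n_def power2_eq_square algebra_simps)
qed

text \<open>A nonpositive gap needs at least \<open>nm/9\<close> triangles, and a sparse graph does not have that many.\<close>

lemma nonpos_gap_dense:
  assumes "finite S" "loopfree E" "r \<ge> 3" "gap r E S \<le> 0" "cliques E S 2 \<noteq> {}"
  shows "(real (card S))\<^sup>2 \<le> 144 * real (card (cliques E S 2))"
proof -
  define n m where "n = real (card S)" and "m = real (card (cliques E S 2))"
  have m: "m > 0" using assms by (simp add: m_def card_gt_0_iff)
  have n: "n \<ge> 0" by (simp add: n_def)
  have "1 / 3 \<le> 1 - 2 / real r" using assms(3) by (simp add: field_simps)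
  then have "1 / 3 * (n * m) \<le> (1 - 2 / real r) * (n * m)" using n m by (intro mult_right_mono) auto
  also have "\<dots> \<le> 3 * real (card (cliques E S 3))"
    using triangle_surplus[OF assms(1,2), of r] assms(4)
      sum_nonneg[of "cliques E S 2" "\<lambda>e. real (card (twice_missed E S e))"]
    by (simp add: n_def m_def)
  finally have "n * (1 / 3 * (n * m)) \<le> n * (3 * real (card (cliques E S 3)))" using n by (rule mult_left_mono)
  also have "\<dots> \<le> m * n\<^sup>2 / 6 + 24 * m\<^sup>2"
    using triangles_le[OF assms(1,2)] by (simp add: n_def m_def)
  finally have "m * n\<^sup>2 \<le> m * (144 * m)" by (simp add: power2_eq_square algebra_simps)
  then show ?thesis using m by (simp add: n_def m_def)
qed

text \<open>The lower bound on triangles propagates upwards to all clique numbers, so each of them is of the largest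
possible order of magnitude.\<close>

lemma clique_lower_bounds:
  assumes S: "finite S" "loopfree E" "S \<noteq> {}" and r: "r > 0"
    and dense: "(real (card S))\<^sup>2 \<le> 144 * real (card (cliques E S 2))"
    and tri: "(1 - 2 / real r) * real (card S) * real (card (cliques E S 2)) \<le> 3 * real (card (cliques E S 3))"
    and s: "2 \<le> s" "s \<le> r"
  shows "real (card S) ^ s \<le> 144 * real r ^ (2 * s) * real (card (cliques E S s))
    \<and> (1 - real s / real r) * real (card S) * real (card (cliques E S s))
        \<le> real (Suc s) * real (card (cliques E S (Suc s)))"
  using s
proof (induction s rule: dec_induct)
  case base
  have "1 \<le> real r ^ 4" using r by (simp add: Suc_le_eq)
  then have "144 * real (card (cliques E S 2)) \<le> 144 * real (card (cliques E S 2)) * real r ^ 4"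
    by (simp add: mult_le_cancel_left1)
  then show ?case using dense tri by (simp add: eval_nat_numeral mult_ac)
next
  case (step s)
  define n where "n = real (card S)"
  have n: "n > 0" using S by (simp add: n_def card_gt_0_iff)
  from step have IH: "n ^ s \<le> 144 * real r ^ (2 * s) * real (card (cliques E S s))"
    "(1 - real s / real r) * n * real (card (cliques E S s)) \<le> real (Suc s) * real (card (cliques E S (Suc s)))"
    by (simp_all add: n_def)
  have ne: "cliques E S s \<noteq> {}"
  proof
    assume "cliques E S s = {}"
    then have "n ^ s \<le> 0" using IH(1) by simp
    then show False using zero_less_power[OF n, of s] by linarith
  qed
  have "1 / real r \<le> 1 - real s / real r" using step r by (simp add: field_simps)
  then have "1 / real r * (n * real (card (cliques E S s))) \<le> (1 - real s / real r) * (n * real (card (cliques E S s)))"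
    using n by (intro mult_right_mono) auto
  also have "\<dots> \<le> real (Suc s) * real (card (cliques E S (Suc s)))" using IH(2) by simp
  also have "\<dots> \<le> real r * real (card (cliques E S (Suc s)))" using step by (intro mult_right_mono) auto
  finally have up: "n * real (card (cliques E S s)) \<le> (real r)\<^sup>2 * real (card (cliques E S (Suc s)))"
    using r by (simp add: field_simps power2_eq_square)
  have "n ^ Suc s \<le> n * (144 * real r ^ (2 * s) * real (card (cliques E S s)))"
    using IH(1) n by simp
  also have "\<dots> = 144 * real r ^ (2 * s) * (n * real (card (cliques E S s)))" by simp
  also have "\<dots> \<le> 144 * real r ^ (2 * s) * ((real r)\<^sup>2 * real (card (cliques E S (Suc s))))"
    using up by (intro mult_left_mono) auto
  also have "\<dots> = 144 * real r ^ (2 * Suc s) * real (card (cliques E S (Suc s)))"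
    by (simp add: power2_eq_square)
  finally show ?case
    using clique_ratio_lower_step[OF S(1,2) r _ ne] IH(2) step by (simp add: n_def)
qed

lemma clique_upper_bounds:
  fixes \<eta> :: real
  assumes S: "finite S" "loopfree E" and r: "r > 0" and \<eta>: "\<eta> \<ge> 0"
    and ne: "\<And>s. 2 \<le> s \<Longrightarrow> s \<le> r \<Longrightarrow> cliques E S s \<noteq> {}"
    and top: "real (Suc r) * real (card (cliques E S (Suc r))) \<le> \<eta> * real (card S) * real (card (cliques E S r))"
    and s: "s \<le> r" "2 \<le> s"
  shows "real (Suc s) * real (card (cliques E S (Suc s)))
      \<le> (1 - real s / real r + \<eta>) * real (card S) * real (card (cliques E S s))"
  using s
proof (induction s rule: inc_induct)
  case base
  then show ?case using top r by simp
next
  case (step s)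
  then show ?case using clique_ratio_upper_step[OF S r \<eta>, of s] ne[of "Suc s"] by auto
qed

text \<open>With \<open>s\<close> the sum over \<open>K\<close>, the right-hand side exceeds the left-hand side by exactly \<open>s\<^sup>2\<close>.\<close>

lemma sum_squares_le_pair_squares:
  fixes y :: "'v \<Rightarrow> real"
  assumes "finite K" "card K = 3"
  shows "(\<Sum>v\<in>K. (y v)\<^sup>2) \<le> (\<Sum>v\<in>K. (sum y (K - {v}))\<^sup>2)"
proof -
  define s where "s = sum y K"
  have "(\<Sum>v\<in>K. (sum y (K - {v}))\<^sup>2) = (\<Sum>v\<in>K. (s - y v)\<^sup>2)"
    using assms by (intro sum.cong) (auto simp: sum_diff1 s_def)
  also have "\<dots> = (\<Sum>v\<in>K. s\<^sup>2 + (y v)\<^sup>2 - 2 * s * y v)"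
    by (intro sum.cong) (auto simp: power2_eq_square algebra_simps)
  also have "\<dots> = 3 * s\<^sup>2 + (\<Sum>v\<in>K. (y v)\<^sup>2) - 2 * s * s"
    using assms by (simp add: sum.distrib sum_subtractf sum_distrib_left[symmetric] s_def)
  also have "\<dots> = s\<^sup>2 + (\<Sum>v\<in>K. (y v)\<^sup>2)" by (simp add: power2_eq_square)
  finally show ?thesis by simp
qed

text \<open>Passes from sums over the two ends of an edge to the single ends: inside a triangle, the three pair
sums control the three values, and summing over all triangles weights each edge by its number of common
neighbours. No such inequality holds along edges alone, where the two ends may cancel.\<close>

lemma triangle_transfer:
  fixes y :: "'v \<Rightarrow> real"
  assumes "finite S" "loopfree E"
  shows "(\<Sum>e\<in>cliques E S 2. real (card (common_nbrs E S e)) * (\<Sum>u\<in>e. (y u)\<^sup>2))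
    \<le> 2 * (\<Sum>e\<in>cliques E S 2. real (card (common_nbrs E S e)) * (sum y e)\<^sup>2)"
proof -
  have "(\<Sum>e\<in>cliques E S 2. real (card (common_nbrs E S e)) * (\<Sum>u\<in>e. (y u)\<^sup>2))
      = (\<Sum>K\<in>cliques E S (Suc 2). \<Sum>v\<in>K. \<Sum>u\<in>K - {v}. (y u)\<^sup>2)"
    using sum_cliques_remove[OF assms, where s = 2 and g = "\<lambda>e. \<Sum>u\<in>e. (y u)\<^sup>2"] by simp
  also have "\<dots> \<le> (\<Sum>K\<in>cliques E S (Suc 2). 2 * (\<Sum>v\<in>K. (sum y (K - {v}))\<^sup>2))"
  proof (rule sum_mono)
    fix K assume "K \<in> cliques E S (Suc 2)"
    then have K: "finite K" "card K = 3" using assms finite_clique by (auto simp: cliques_def)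
    show "(\<Sum>v\<in>K. \<Sum>u\<in>K - {v}. (y u)\<^sup>2) \<le> 2 * (\<Sum>v\<in>K. (sum y (K - {v}))\<^sup>2)"
      using sum_sum_remove[OF K(1), of "\<lambda>u. (y u)\<^sup>2"] sum_squares_le_pair_squares[OF K, of y] K by simp
  qed
  also have "\<dots> = 2 * (\<Sum>e\<in>cliques E S 2. real (card (common_nbrs E S e)) * (sum y e)\<^sup>2)"
    using sum_cliques_remove[OF assms, where s = 2 and g = "\<lambda>e. (sum y e)\<^sup>2"]
    by (simp add: sum_distrib_left[symmetric])
  finally show ?thesis .
qed

text \<open>A vertex of degree below \<open>m/(2n)\<close> has fewer than \<open>m/2\<close> edges meeting its neighbourhood, so it is adjacent to
neither end of at least half of the edges.\<close>

lemma low_degree_vertices_missed: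
  assumes S: "finite S" "loopfree E"
  defines "m \<equiv> real (card (cliques E S 2))" and "n \<equiv> real (card S)"
  shows "real (card {w \<in> S. 2 * n * real (deg E S w) < m}) * m
    \<le> 2 * (\<Sum>e\<in>cliques E S 2. real (card (twice_missed E S e)))"
proof -
  define L where "L = {w \<in> S. 2 * n * real (deg E S w) < m}"
  have inc: "card {e \<in> cliques E S 2. x \<in> e} \<le> card S" for x
  proof -
    have "{e \<in> cliques E S 2. x \<in> e} \<subseteq> (\<lambda>y. {x, y}) ` S"
      by (auto simp: cliques_def card_2_iff)
    then have "card {e \<in> cliques E S 2. x \<in> e} \<le> card ((\<lambda>y. {x, y}) ` S)"
      using S by (intro card_mono) auto
    also have "\<dots> \<le> card S" using S by (intro card_image_le)
    finally show ?thesis .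
  qed
  have half: "m / 2 \<le> real (card {e \<in> cliques E S 2. w \<in> twice_missed E S e})" if w: "w \<in> L" for w
  proof -
    define X where "X = {e \<in> cliques E S 2. w \<in> twice_missed E S e}"
    have "cliques E S 2 - X \<subseteq> (\<Union>x\<in>common_nbrs E S {w}. {e \<in> cliques E S 2. x \<in> e})"
    proof
      fix e assume e: "e \<in> cliques E S 2 - X"
      then obtain u v where uv: "e = {u, v}" "u \<noteq> v" "u \<in> S" "v \<in> S" by (auto simp: cliques_def card_2_iff)
      have "{u, w} \<in> E \<or> {v, w} \<in> E" using e w uv by (auto simp: X_def L_def twice_missed_def)
      then show "e \<in> (\<Union>x\<in>common_nbrs E S {w}. {e \<in> cliques E S 2. x \<in> e})"
        using e uv by (auto simp: common_nbrs_def insert_commute)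
    qed
    then have "card (cliques E S 2 - X) \<le> card (\<Union>x\<in>common_nbrs E S {w}. {e \<in> cliques E S 2. x \<in> e})"
      using S by (intro card_mono) auto
    also have "\<dots> \<le> (\<Sum>x\<in>common_nbrs E S {w}. card {e \<in> cliques E S 2. x \<in> e})"
      using S by (intro card_UN_le) auto
    also have "\<dots> \<le> deg E S w * card S" using sum_bounded_above[OF inc] by simp
    finally have "real (card (cliques E S 2 - X)) \<le> real (deg E S w) * n"
      unfolding n_def by (simp only: of_nat_le_iff of_nat_mult[symmetric])
    moreover have "card (cliques E S 2 - X) = card (cliques E S 2) - card X" "card X \<le> card (cliques E S 2)"
      using S by (auto simp: X_def intro!: card_Diff_subset card_mono)
    moreover have "2 * n * real (deg E S w) < m" using w by (simp add: L_def)
    ultimately show ?thesis by (simp add: X_def[symmetric] m_def of_nat_diff algebra_simps)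
  qed
  have "real (card L) * (m / 2) \<le> (\<Sum>w\<in>L. real (card {e \<in> cliques E S 2. w \<in> twice_missed E S e}))"
    using sum_bounded_below[OF half] by simp
  also have "\<dots> \<le> (\<Sum>w\<in>S. real (card {e \<in> cliques E S 2. w \<in> twice_missed E S e}))"
    using S by (intro sum_mono2) (auto simp: L_def)
  also have "\<dots> = (\<Sum>w\<in>S. \<Sum>e\<in>cliques E S 2. of_bool (w \<in> twice_missed E S e))"
    using S by (simp add: sum_of_bool_eq Int_def)
  also have "\<dots> = (\<Sum>e\<in>cliques E S 2. \<Sum>w\<in>S. of_bool (w \<in> twice_missed E S e))" by (rule sum.swap)
  also have "\<dots> = (\<Sum>e\<in>cliques E S 2. real (card (twice_missed E S e)))"
    using S by (simp add: sum_of_bool_eq Int_def twice_missed_def)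
  finally show ?thesis by (simp add: L_def)
qed

text \<open>With \<open>y\<close> the deviation of the degrees, \<open>k3\<close> and \<open>k4\<close> bound the variance of the numbers of common
neighbours and the total defect, hence the squares of the pair sums of \<open>y\<close> over the edges. Triangles
transfer this to the values of \<open>y\<close> at the ends of the edges, that is, to the squares of \<open>y\<close> weighted by the
degrees. The weights are bounded below except at the vertices of low degree, and those are few because
they contribute to the defect.\<close>

lemma degrees_concentrate:
  fixes \<eta> :: real
  assumes S: "finite S" "loopfree E" and r: "r \<ge> 3" and \<eta>: "\<eta> \<ge> 0"
    and gap: "gap r E S \<le> 0" and ne: "cliques E S 2 \<noteq> {}"
    and k3: "3 * real (card (cliques E S 3)) \<le> (1 - 2 / real r + \<eta>) * real (card S) * real (card (cliques E S 2))"
    and k4: "4 * real (card (cliques E S 4)) \<le> (1 - 3 / real r + \<eta>) * real (card S) * real (card (cliques E S 3))"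
  shows "(\<Sum>u\<in>S. (real (deg E S u) - (1 - 1 / real r) * real (card S))\<^sup>2) \<le> 134 * \<eta> * real (card S) ^ 3"
proof -
  define n m T where "n = real (card S)" and "m = real (card (cliques E S 2))"
    and "T = 3 * real (card (cliques E S 3))"
  define \<alpha> where "\<alpha> = 1 - 2 / real r"
  define t z where "t e = real (card (common_nbrs E S e))" and "z e = real (card (twice_missed E S e))" for e
  define y where "y u = real (deg E S u) - (1 - 1 / real r) * n" for u
  have m: "m > 0" using S ne by (simp add: m_def card_gt_0_iff)
  have n: "n > 0"
  proof -
    have "S \<noteq> {}" using ne by (auto simp: cliques_def)
    then show ?thesis using S by (simp add: n_def card_gt_0_iff)
  qed
  have \<alpha>: "1 / 3 \<le> \<alpha>" using r by (simp add: \<alpha>_def field_simps)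
  have t_le: "t e \<le> n" for e using card_common_nbrs_le[OF S(1)] by (simp add: t_def n_def)
  have z_le: "0 \<le> z e" "z e \<le> n" for e
    using S by (auto simp: z_def n_def twice_missed_def intro: card_mono)
  have t0: "0 \<le> t e" for e by (simp add: t_def)
  have sum_t: "(\<Sum>e\<in>cliques E S 2. t e) = T"
    using sum_card_common_nbrs[OF S, of 2] by (simp add: t_def T_def eval_nat_numeral)
  define Z where "Z = (\<Sum>e\<in>cliques E S 2. z e)"
  have Z0: "0 \<le> Z" using z_le by (simp add: Z_def sum_nonneg)
  have surplus: "T = \<alpha> * n * m + Z - gap r E S"
    using triangle_surplus[OF S, of r] by (simp add: T_def \<alpha>_def n_def m_def Z_def z_def)
  have T_le: "T \<le> \<alpha> * n * m + \<eta> * n * m" using k3 by (simp add: T_def \<alpha>_def n_def m_def algebra_simps)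
  have Z: "Z \<le> \<eta> * n * m" using surplus T_le gap by linarith
  have T_ge: "\<alpha> * n * m \<le> T" using surplus gap Z0 by linarith
  have T_nm: "T \<le> n * m"
    using sum_bounded_above[of "cliques E S 2" t n] t_le sum_t by (simp add: m_def mult.commute)
  define V where "V = (\<Sum>e\<in>cliques E S 2. (t e - \<alpha> * n)\<^sup>2)"
  have V: "V \<le> \<eta> * n\<^sup>2 * m"
  proof -
    have "(\<Sum>e\<in>cliques E S 2. (t e)\<^sup>2) \<le> n * (T / 3) + 8 * real (card (cliques E S 4))"
      using sum_common_nbrs_squared_le[OF S, of 2] by (simp add: t_def n_def T_def eval_nat_numeral)
    also have "\<dots> \<le> n * (T / 3) + 2 * ((1 - 3 / real r + \<eta>) * n * (T / 3))"
      using k4 by (simp add: n_def T_def mult_ac)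
    also have "\<dots> = \<alpha> * n * T + 2 / 3 * \<eta> * n * T"
      by (simp add: \<alpha>_def field_simps)
    finally have sq: "(\<Sum>e\<in>cliques E S 2. (t e)\<^sup>2) \<le> \<alpha> * n * T + 2 / 3 * \<eta> * n * T" .
    have "V = (\<Sum>e\<in>cliques E S 2. (t e)\<^sup>2 - 2 * (\<alpha> * n) * t e + (\<alpha> * n)\<^sup>2)"
      unfolding V_def by (intro sum.cong) (auto simp: power2_eq_square algebra_simps)
    also have "\<dots> = (\<Sum>e\<in>cliques E S 2. (t e)\<^sup>2) - 2 * (\<alpha> * n) * T + (\<alpha> * n)\<^sup>2 * m"
      using sum_t by (simp add: sum.distrib sum_subtractf sum_distrib_left[symmetric] m_def)
    also have "\<dots> \<le> 2 / 3 * \<eta> * n * T - \<alpha> * n * (T - \<alpha> * n * m)"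
      using sq by (simp add: power2_eq_square algebra_simps)
    also have "\<dots> \<le> 2 / 3 * \<eta> * n * T"
      using T_ge \<alpha> n by (simp add: mult_nonneg_nonneg)
    also have "\<dots> \<le> \<eta> * n * T"
      using \<eta> n by (simp add: T_def mult_right_mono)
    also have "\<dots> \<le> \<eta> * n * (n * m)" using T_nm \<eta> n by (intro mult_left_mono) auto
    finally show ?thesis by (simp add: power2_eq_square mult_ac)
  qed
  have edge: "sum y e = (t e - \<alpha> * n) - z e" if "e \<in> cliques E S 2" for e
  proof -
    have "card e = 2" using that by (simp add: cliques_def)
    then have "sum y e = (\<Sum>u\<in>e. real (deg E S u)) - 2 * ((1 - 1 / real r) * n)"
      by (simp add: y_def sum_subtractf)
    then show ?thesis using edge_degree_sum[OF S(1) that] by (simp add: t_def z_def n_def \<alpha>_def algebra_simps)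
  qed
  have pairs: "(\<Sum>e\<in>cliques E S 2. (sum y e)\<^sup>2) \<le> 4 * \<eta> * n\<^sup>2 * m"
  proof -
    have "(\<Sum>e\<in>cliques E S 2. (sum y e)\<^sup>2) \<le> (\<Sum>e\<in>cliques E S 2. 2 * (t e - \<alpha> * n)\<^sup>2 + 2 * n * z e)"
    proof (rule sum_mono)
      fix e assume e: "e \<in> cliques E S 2"
      have "z e * z e \<le> n * z e" using z_le by (intro mult_right_mono) auto
      moreover have "0 \<le> ((t e - \<alpha> * n) + z e)\<^sup>2" by simp
      ultimately show "(sum y e)\<^sup>2 \<le> 2 * (t e - \<alpha> * n)\<^sup>2 + 2 * n * z e"
        unfolding edge[OF e] power2_eq_square by (simp add: algebra_simps)
    qed
    also have "\<dots> = 2 * V + 2 * n * Z" by (simp add: sum.distrib sum_distrib_left[symmetric] V_def Z_def)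
    also have "\<dots> \<le> 2 * (\<eta> * n\<^sup>2 * m) + 2 * n * (\<eta> * n * m)"
      using V Z n by (intro add_mono mult_left_mono) auto
    finally show ?thesis by (simp add: power2_eq_square algebra_simps)
  qed
  define Q where "Q e = (\<Sum>u\<in>e. (y u)\<^sup>2)" for e
  have Q0: "0 \<le> Q e" for e by (simp add: Q_def sum_nonneg)
  have y_le: "(y u)\<^sup>2 \<le> n\<^sup>2" for u
  proof -
    have "real (deg E S u) \<le> n" using card_common_nbrs_le[OF S(1), of E "{u}"] by (simp add: n_def)
    moreover have "0 \<le> (1 - 1 / real r) * n" "(1 - 1 / real r) * n \<le> n"
      using r n by (simp_all add: mult_nonneg_nonneg mult_left_le_one_le)
    ultimately have "\<bar>y u\<bar> \<le> \<bar>n\<bar>" unfolding y_def by linarith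
    then show ?thesis by (rule abs_le_square_iff[THEN iffD1])
  qed
  have Q_le: "Q e \<le> 2 * n\<^sup>2" if "e \<in> cliques E S 2" for e
    using sum_bounded_above[of e "\<lambda>u. (y u)\<^sup>2" "n\<^sup>2"] y_le that by (simp add: Q_def cliques_def)
  have "(\<Sum>e\<in>cliques E S 2. t e * Q e) \<le> 2 * (\<Sum>e\<in>cliques E S 2. t e * (sum y e)\<^sup>2)"
    using triangle_transfer[OF S, of y] by (simp add: t_def Q_def)
  also have "(\<Sum>e\<in>cliques E S 2. t e * (sum y e)\<^sup>2) \<le> (\<Sum>e\<in>cliques E S 2. n * (sum y e)\<^sup>2)"
    using t_le by (intro sum_mono mult_right_mono) auto
  also have "\<dots> \<le> n * (4 * \<eta> * n\<^sup>2 * m)"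
    using pairs n by (simp add: sum_distrib_left[symmetric])
  finally have tQ: "(\<Sum>e\<in>cliques E S 2. t e * Q e) \<le> 2 * (n * (4 * \<eta> * n\<^sup>2 * m))" by simp
  have "(\<Sum>e\<in>cliques E S 2. n\<^sup>2 / 6 * Q e) \<le> (\<Sum>e\<in>cliques E S 2. n * (t e * Q e) + 3 * n\<^sup>2 * (t e - \<alpha> * n)\<^sup>2)"
  proof (rule sum_mono)
    fix e assume e: "e \<in> cliques E S 2"
    define x where "x = t e - \<alpha> * n"
    \<comment> \<open>Since \<open>\<alpha> \<ge> 1/3\<close>, an edge with few common neighbours has a large deviation \<open>x\<close>.\<close>
    have "0 \<le> 3 / 2 * (x + n / 3)\<^sup>2" by simp
    moreover have "1 / 3 * n\<^sup>2 \<le> \<alpha> * n\<^sup>2" using \<alpha> by (intro mult_right_mono) auto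
    ultimately have "n\<^sup>2 / 6 \<le> n * t e + 3 / 2 * x\<^sup>2"
      by (simp add: x_def power2_eq_square algebra_simps)
    then have "n\<^sup>2 / 6 * Q e \<le> (n * t e + 3 / 2 * x\<^sup>2) * Q e" using Q0 by (intro mult_right_mono) auto
    also have "\<dots> = n * (t e * Q e) + 3 / 2 * x\<^sup>2 * Q e" by (simp add: algebra_simps)
    also have "\<dots> \<le> n * (t e * Q e) + 3 / 2 * x\<^sup>2 * (2 * n\<^sup>2)"
      using Q_le[OF e] by (intro add_left_mono mult_left_mono) auto
    finally show "n\<^sup>2 / 6 * Q e \<le> n * (t e * Q e) + 3 * n\<^sup>2 * (t e - \<alpha> * n)\<^sup>2" by (simp add: x_def mult_ac)
  qed
  also have "\<dots> = n * (\<Sum>e\<in>cliques E S 2. t e * Q e) + 3 * n\<^sup>2 * V"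
    by (simp add: sum.distrib sum_distrib_left[symmetric] V_def)
  also have "\<dots> \<le> n * (2 * (n * (4 * \<eta> * n\<^sup>2 * m))) + 3 * n\<^sup>2 * (\<eta> * n\<^sup>2 * m)"
    using tQ V n by (intro add_mono mult_left_mono) auto
  finally have "n\<^sup>2 / 6 * (\<Sum>e\<in>cliques E S 2. Q e) \<le> n * (2 * (n * (4 * \<eta> * n\<^sup>2 * m))) + 3 * n\<^sup>2 * (\<eta> * n\<^sup>2 * m)"
    by (simp only: sum_distrib_left)
  then have "n\<^sup>2 * (\<Sum>e\<in>cliques E S 2. Q e) \<le> n\<^sup>2 * (66 * \<eta> * n\<^sup>2 * m)"
    by (simp add: power2_eq_square algebra_simps)
  then have "(\<Sum>e\<in>cliques E S 2. Q e) \<le> 66 * \<eta> * n\<^sup>2 * m" using n by simp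
  then have weighted: "(\<Sum>u\<in>S. real (deg E S u) * (y u)\<^sup>2) \<le> 66 * \<eta> * n\<^sup>2 * m"
    using sum_edges_ends[OF S, of "\<lambda>u. (y u)\<^sup>2"] by (simp add: Q_def)
  \<comment> \<open>Outside \<open>L\<close> the weight \<open>deg E S u\<close> is at least \<open>m/(2n)\<close>.\<close>
  define L where "L = {w \<in> S. 2 * n * real (deg E S w) < m}"
  have "real (card L) * m \<le> 2 * Z"
    using low_degree_vertices_missed[OF S] by (simp add: L_def Z_def z_def n_def m_def)
  then have "real (card L) * m \<le> (2 * \<eta> * n) * m" using Z by simp
  then have L: "real (card L) \<le> 2 * \<eta> * n" using m by simp
  have "(\<Sum>u\<in>S. m * (y u)\<^sup>2) \<le> (\<Sum>u\<in>S. m * n\<^sup>2 * of_bool (u \<in> L) + 2 * n * (real (deg E S u) * (y u)\<^sup>2))"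
  proof (rule sum_mono)
    fix u assume u: "u \<in> S"
    show "m * (y u)\<^sup>2 \<le> m * n\<^sup>2 * of_bool (u \<in> L) + 2 * n * (real (deg E S u) * (y u)\<^sup>2)"
    proof (cases "u \<in> L")
      case True
      have "m * (y u)\<^sup>2 \<le> m * n\<^sup>2" using y_le m by simp
      moreover have "0 \<le> 2 * n * (real (deg E S u) * (y u)\<^sup>2)" using n by simp
      ultimately have "m * (y u)\<^sup>2 \<le> m * n\<^sup>2 + 2 * n * (real (deg E S u) * (y u)\<^sup>2)" by linarith
      then show ?thesis using True by simp
    next
      case False
      then have "m \<le> 2 * n * real (deg E S u)" using u by (simp add: L_def)
      then have "m * (y u)\<^sup>2 \<le> 2 * n * real (deg E S u) * (y u)\<^sup>2" by (intro mult_right_mono) auto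
      then show ?thesis using False by (simp add: mult_ac)
    qed
  qed
  also have "\<dots> = m * n\<^sup>2 * real (card L) + 2 * n * (\<Sum>u\<in>S. real (deg E S u) * (y u)\<^sup>2)"
  proof -
    have "(\<Sum>u\<in>S. of_bool (u \<in> L)) = real (card L)" using S by (simp add: sum_of_bool_eq Int_def L_def)
    then show ?thesis by (simp only: sum.distrib sum_distrib_left[symmetric])
  qed
  also have "\<dots> \<le> m * n\<^sup>2 * (2 * \<eta> * n) + 2 * n * (66 * \<eta> * n\<^sup>2 * m)"
    using L weighted n m by (intro add_mono mult_left_mono) auto
  also have "\<dots> = m * (134 * \<eta> * n ^ 3)" by (simp add: power2_eq_square power3_eq_cube algebra_simps)
  finally have "m * (\<Sum>u\<in>S. (y u)\<^sup>2) \<le> m * (134 * \<eta> * n ^ 3)" by (simp add: sum_distrib_left[symmetric])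
  then show ?thesis using m by (simp add: y_def n_def)
qed

text \<open>Only few cliques of size \<open>r + 1\<close> can occur, since a blow-up of such a clique contains the excluded
configuration. This starts the downward chain of upper bounds on the clique ratios, which ends in the
hypotheses of \<open>degrees_concentrate\<close>.\<close>

lemma nonpos_gap_degrees_concentrate:
  fixes \<kappa> :: real
  assumes "\<kappa> > 0" "r \<ge> 3" "N > 0"
  shows "\<exists>n0. \<forall>E (S :: 'v set). finite S \<longrightarrow> loopfree E \<longrightarrow> n0 \<le> card S \<longrightarrow> plus_edge_free E S r N \<longrightarrow>
    gap r E S \<le> 0 \<longrightarrow> cliques E S 2 \<noteq> {} \<longrightarrow>
    (\<Sum>u\<in>S. (real (deg E S u) - (1 - 1 / real r) * real (card S))\<^sup>2) \<le> \<kappa> * real (card S) ^ 3"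
proof -
  define \<eta> where "\<eta> = \<kappa> / 134"
  define \<epsilon> where "\<epsilon> = \<eta> / ((real r + 1) * (144 * real r ^ (2 * r)))"
  have \<eta>: "\<eta> > 0" using assms by (simp add: \<eta>_def)
  have "\<epsilon> > 0" using assms \<eta> by (simp add: \<epsilon>_def)
  from many_cliques_give_blowup[OF this, of "Suc r" N] obtain n1 where n1:
    "\<And>n E (S :: 'v set). n1 \<le> n \<Longrightarrow> finite S \<Longrightarrow> loopfree E \<Longrightarrow> card S \<le> n \<Longrightarrow>
      \<epsilon> * real n ^ Suc r \<le> real (card (cliques E S (Suc r))) \<Longrightarrow>
      \<exists>P. joined E (Suc r) P \<and> (\<forall>i<Suc r. P i \<subseteq> S \<and> card (P i) = N)" by metis
  show ?thesis
  proof (intro exI[of _ n1] allI impI)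
    fix E and S :: "'v set"
    assume S: "finite S" "loopfree E" and large: "n1 \<le> card S" and free: "plus_edge_free E S r N"
      and gap: "gap r E S \<le> 0" and ne: "cliques E S 2 \<noteq> {}"
    define n where "n = real (card S)"
    have S_ne: "S \<noteq> {}" using ne by (auto simp: cliques_def)
    then have n: "n > 0" using S by (simp add: n_def card_gt_0_iff)
    have few: "real (card (cliques E S (Suc r))) < \<epsilon> * n ^ Suc r"
    proof (rule ccontr)
      assume "\<not> ?thesis"
      then obtain P where P: "joined E (Suc r) P" "\<forall>i<Suc r. P i \<subseteq> S \<and> card (P i) = N"
        using n1[OF large S order_refl] unfolding n_def by (meson not_less)
      have "P r \<noteq> {}" using P(2) assms(3) by (metis card.empty lessI less_not_refl)
      then obtain v where v: "v \<in> P r" by blast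
      have "v \<in> S" using v P(2) by blast
      have "joined E r P" using P(1) unfolding joined_def by (meson less_Suc_eq)
      then obtain i where i: "i < r" "card (common_nbrs E S {v} \<inter> P i) < N"
        using few_neighbours_in_some_part[OF free S(1) _ _ \<open>v \<in> S\<close> assms(3), of P] P(2) assms(2) by auto
      have "common_nbrs E S {v} \<inter> P i = P i"
        using i joinedD[OF P(1), of r i v] v P(2)[rule_format, of i] by (auto simp: common_nbrs_def)
      then show False using i P(2) by simp
    qed
    have dense: "(real (card S))\<^sup>2 \<le> 144 * real (card (cliques E S 2))"
      by (rule nonpos_gap_dense[OF S assms(2) gap ne])
    have tri: "(1 - 2 / real r) * real (card S) * real (card (cliques E S 2)) \<le> 3 * real (card (cliques E S 3))"
      using triangle_surplus[OF S, of r] gap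
        sum_nonneg[of "cliques E S 2" "\<lambda>e. real (card (twice_missed E S e))"] by simp
    have r0: "r > 0" using assms by simp
    have low: "n ^ s \<le> 144 * real r ^ (2 * s) * real (card (cliques E S s))" if "2 \<le> s" "s \<le> r" for s
      using clique_lower_bounds[OF S S_ne r0 dense tri that] by (simp add: n_def)
    have ne_s: "cliques E S s \<noteq> {}" if "2 \<le> s" "s \<le> r" for s
    proof
      assume "cliques E S s = {}"
      then have "n ^ s \<le> 0" using low[OF that] by simp
      then show False using zero_less_power[OF n, of s] by linarith
    qed
    have "real (Suc r) * real (card (cliques E S (Suc r))) \<le> (real r + 1) * (\<epsilon> * n ^ Suc r)"
      using few by (simp add: add.commute mult_left_mono)
    also have "\<dots> = \<eta> / (144 * real r ^ (2 * r)) * n * n ^ r"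
    proof -
      have "a * (\<eta> / (a * C) * n ^ Suc r) = \<eta> / C * n * n ^ r" if "a \<noteq> 0" for a C using that by simp
      from this[of "real r + 1" "144 * real r ^ (2 * r)"] show ?thesis by (simp add: \<epsilon>_def)
    qed
    also have "\<dots> \<le> \<eta> / (144 * real r ^ (2 * r)) * n * (144 * real r ^ (2 * r) * real (card (cliques E S r)))"
      using low[of r] assms \<eta> n by (intro mult_left_mono) auto
    also have "\<dots> = \<eta> * n * real (card (cliques E S r))" using r0 by simp
    finally have top: "real (Suc r) * real (card (cliques E S (Suc r))) \<le> \<eta> * real (card S) * real (card (cliques E S r))"
      by (simp add: n_def)
    have up: "real (Suc s) * real (card (cliques E S (Suc s)))
      \<le> (1 - real s / real r + \<eta>) * real (card S) * real (card (cliques E S s))" if "2 \<le> s" "s \<le> r" for s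
      using clique_upper_bounds[OF S r0 _ ne_s top that(2,1)] \<eta> by auto
    have "(\<Sum>u\<in>S. (real (deg E S u) - (1 - 1 / real r) * real (card S))\<^sup>2) \<le> 134 * \<eta> * real (card S) ^ 3"
      using up[of 2] up[of 3] assms \<eta>
      by (intro degrees_concentrate[OF S assms(2) _ gap ne]) (auto simp: eval_nat_numeral)
    then show "(\<Sum>u\<in>S. (real (deg E S u) - (1 - 1 / real r) * real (card S))\<^sup>2) \<le> \<kappa> * real (card S) ^ 3"
      by (simp add: \<eta>_def)
  qed
qed

section \<open>The gap under vertex removal and in multipartite graphs\<close>

lemma gap_delete_vertex:
  fixes r :: nat
  assumes S: "finite S" "loopfree E" and v: "v \<in> S"
  defines "n \<equiv> real (card S)" and "m \<equiv> real (card (cliques E S 2))" and "\<alpha> \<equiv> 1 - 1 / real r"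
  shows "gap r E S - gap r E (S - {v}) = 2 * \<alpha> * m - (real (deg E S v))\<^sup>2 - (2 * \<alpha> - 1) * real (deg E S v)
     - 2 * (\<Sum>u\<in>common_nbrs E S {v}. real (deg E S u) - \<alpha> * n)"
proof -
  define d where "d = real (deg E S v)"
  define A where "A u = (of_bool (u \<in> common_nbrs E S {v}) :: real)" for u
  have v_notin: "v \<notin> common_nbrs E S {v}" using S(2) by (auto simp: common_nbrs_def loopfree_def)
  then have N_sub: "common_nbrs E S {v} \<subseteq> S - {v}" by (auto simp: common_nbrs_def)
  have deg': "real (deg E (S - {v}) u) = real (deg E S u) - A u" if "u \<in> S - {v}" for u
  proof -
    have "common_nbrs E (S - {v}) {u} = common_nbrs E S {u} - {v}" by (auto simp: common_nbrs_def)
    moreover have "v \<in> common_nbrs E S {u} \<longleftrightarrow> u \<in> common_nbrs E S {v}" using that v by (auto simp: common_nbrs_def insert_commute)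
    moreover have "v \<in> common_nbrs E S {u} \<Longrightarrow> card (common_nbrs E S {u}) > 0" using S by (auto simp: card_gt_0_iff)
    ultimately show ?thesis using S by (auto simp: A_def of_nat_diff Suc_le_eq)
  qed
  have sumA: "(\<Sum>u\<in>S - {v}. A u * g u) = (\<Sum>u\<in>common_nbrs E S {v}. g u)" for g
    using S N_sub by (intro sum.mono_neutral_cong_right) (auto simp: A_def)
  have card': "real (card (S - {v})) = n - 1"
  proof -
    have "0 < card S" using S v by (auto simp: card_gt_0_iff)
    then show ?thesis using v by (simp add: n_def of_nat_diff Suc_le_eq)
  qed
  have "2 * real (card (cliques E (S - {v}) 2)) = (\<Sum>u\<in>S - {v}. real (deg E S u) - A u * 1)"
    using sum_deg[of "S - {v}" E] S deg' by simp
  also have "\<dots> = (\<Sum>u\<in>S - {v}. real (deg E S u)) - d"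
    unfolding sum_subtractf sumA by (simp add: d_def)
  also have "\<dots> = 2 * m - d - d"
    using sum_deg[OF S] S v by (simp add: sum_diff1 d_def m_def)
  finally have m': "real (card (cliques E (S - {v}) 2)) = m - d" by simp
  have "(\<Sum>u\<in>S - {v}. (real (deg E (S - {v}) u))\<^sup>2)
      = (\<Sum>u\<in>S - {v}. (real (deg E S u))\<^sup>2 - A u * (2 * real (deg E S u) - 1))"
  proof (rule sum.cong)
    fix u assume u: "u \<in> S - {v}"
    show "(real (deg E (S - {v}) u))\<^sup>2 = (real (deg E S u))\<^sup>2 - A u * (2 * real (deg E S u) - 1)"
      unfolding deg'[OF u] by (auto simp: A_def power2_eq_square algebra_simps)
  qed simp
  also have "\<dots> = (\<Sum>u\<in>S. (real (deg E S u))\<^sup>2) - d\<^sup>2 - (\<Sum>u\<in>common_nbrs E S {v}. 2 * real (deg E S u) - 1)"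
    unfolding sum_subtractf[of _ _ "S - {v}"] sumA using S v by (simp add: sum_diff1 d_def)
  also have "(\<Sum>u\<in>common_nbrs E S {v}. 2 * real (deg E S u) - 1)
      = 2 * (\<Sum>u\<in>common_nbrs E S {v}. real (deg E S u) - \<alpha> * n) + 2 * (\<alpha> * n) * d - d"
    by (simp add: sum_subtractf sum_distrib_left d_def)
  finally have "gap r E (S - {v}) = 2 * \<alpha> * (m - d) * (n - 1) - ((\<Sum>u\<in>S. (real (deg E S u))\<^sup>2) - d\<^sup>2
      - (2 * (\<Sum>u\<in>common_nbrs E S {v}. real (deg E S u) - \<alpha> * n) + 2 * (\<alpha> * n) * d - d))"
    by (simp add: gap_def m' card' \<alpha>_def)
  moreover have "gap r E S = 2 * \<alpha> * m * n - (\<Sum>u\<in>S. (real (deg E S u))\<^sup>2)"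
    by (simp add: gap_def m_def n_def \<alpha>_def)
  ultimately show ?thesis by (simp add: d_def[symmetric] algebra_simps)
qed

text \<open>If all degrees were exactly \<open>\<alpha>n\<close> with \<open>\<alpha> = 1 - 1/r\<close>, then removing a vertex of degree \<open>d\<close> would lower the
gap by \<open>\<alpha>\<^sup>2n\<^sup>2 - d\<^sup>2\<close> up to a linear term. Concentration makes the deviations of the degrees from \<open>\<alpha>n\<close>
contribute only a small multiple of \<open>\<epsilon>n\<^sup>2\<close>.\<close>

lemma gap_drops_at_low_degree_vertex:
  fixes \<epsilon> :: real
  assumes S: "finite S" "loopfree E" and v: "v \<in> S" and r: "r \<ge> 3" and \<epsilon>: "0 < \<epsilon>" "\<epsilon> \<le> 1 / 6"
    and large: "3 / \<epsilon> \<le> real (card S)"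
    and low: "real (deg E S v) < (1 - 1 / real r - \<epsilon>) * real (card S)"
    and conc: "(\<Sum>u\<in>S. (real (deg E S u) - (1 - 1 / real r) * real (card S))\<^sup>2) \<le> \<epsilon>\<^sup>2 / 400 * real (card S) ^ 3"
  shows "gap r E (S - {v}) + \<epsilon> / 2 * (real (card S))\<^sup>2 \<le> gap r E S"
proof -
  define n m \<alpha> d where "n = real (card S)" and "m = real (card (cliques E S 2))"
    and "\<alpha> = 1 - 1 / real r" and "d = real (deg E S v)"
  define y where "y u = real (deg E S u) - \<alpha> * n" for u
  have \<alpha>: "2 / 3 \<le> \<alpha>" "\<alpha> \<le> 1" using r by (simp_all add: \<alpha>_def field_simps)
  have "0 < 3 / \<epsilon>" using \<epsilon> by simp
  then have "0 < n" using large unfolding n_def by linarith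
  moreover have "3 \<le> \<epsilon> * n" using large \<epsilon> by (simp add: n_def field_simps)
  ultimately have n: "n > 0" "3 \<le> \<epsilon> * n" by auto
  define Y where "Y = (\<Sum>u\<in>S. \<bar>y u\<bar>)"
  \<comment> \<open>The total deviation \<open>Y\<close> is bounded through the sum of squares by the inequality of arithmetic and geometric means.\<close>
  have "(\<Sum>u\<in>S. \<epsilon> * n * \<bar>y u\<bar>) \<le> (\<Sum>u\<in>S. \<epsilon>\<^sup>2 * n\<^sup>2 / 40 + 10 * (y u)\<^sup>2)"
  proof (rule sum_mono)
    fix u
    have "0 \<le> 10 * (\<bar>y u\<bar> - \<epsilon> * n / 20)\<^sup>2" by simp
    also have "\<dots> = 10 * (y u)\<^sup>2 - \<epsilon> * n * \<bar>y u\<bar> + \<epsilon>\<^sup>2 * n\<^sup>2 / 40"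
      by (simp add: power2_diff power_mult_distrib power_divide algebra_simps)
    finally show "\<epsilon> * n * \<bar>y u\<bar> \<le> \<epsilon>\<^sup>2 * n\<^sup>2 / 40 + 10 * (y u)\<^sup>2" by simp
  qed
  also have "\<dots> = n * (\<epsilon>\<^sup>2 * n\<^sup>2 / 40) + 10 * (\<Sum>u\<in>S. (y u)\<^sup>2)"
    by (simp add: sum.distrib sum_distrib_left n_def)
  also have "\<dots> \<le> n * (\<epsilon>\<^sup>2 * n\<^sup>2 / 40) + 10 * (\<epsilon>\<^sup>2 / 400 * n ^ 3)"
    using conc by (simp add: y_def n_def \<alpha>_def)
  also have "\<dots> = \<epsilon> * n * (\<epsilon> * n\<^sup>2 / 20)" by (simp add: power2_eq_square power3_eq_cube)
  finally have "\<epsilon> * n * Y \<le> \<epsilon> * n * (\<epsilon> * n\<^sup>2 / 20)" by (simp add: sum_distrib_left Y_def)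
  then have Y: "Y \<le> \<epsilon> * n\<^sup>2 / 20" using \<epsilon> n by simp
  have "2 * m = (\<Sum>u\<in>S. y u) + \<alpha> * n\<^sup>2"
    using sum_deg[OF S] by (simp add: y_def sum_subtractf m_def n_def power2_eq_square)
  moreover have "- Y \<le> (\<Sum>u\<in>S. y u)"
    using sum_abs[of y S] by (simp add: Y_def abs_le_iff)
  moreover have "0 \<le> Y" by (simp add: Y_def sum_nonneg)
  ultimately have f1: "\<alpha> * (\<alpha> * n\<^sup>2) - Y \<le> \<alpha> * (2 * m)"
  proof -
    assume *: "2 * m = (\<Sum>u\<in>S. y u) + \<alpha> * n\<^sup>2" "- Y \<le> (\<Sum>u\<in>S. y u)" "0 \<le> Y"
    have "\<alpha> * Y \<le> Y" using * \<alpha> by (simp add: mult_left_le_one_le)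
    moreover have "\<alpha> * (\<alpha> * n\<^sup>2 - Y) \<le> \<alpha> * (2 * m)" using * \<alpha> by (intro mult_left_mono) auto
    ultimately show ?thesis by (simp add: algebra_simps)
  qed
  have f2: "(\<Sum>u\<in>common_nbrs E S {v}. y u) \<le> Y"
  proof -
    have "(\<Sum>u\<in>common_nbrs E S {v}. y u) \<le> (\<Sum>u\<in>common_nbrs E S {v}. \<bar>y u\<bar>)" by (intro sum_mono) auto
    also have "\<dots> \<le> Y" unfolding Y_def using S by (intro sum_mono2) (auto simp: common_nbrs_def)
    finally show ?thesis .
  qed
  have f3: "d\<^sup>2 \<le> ((\<alpha> - \<epsilon>) * n)\<^sup>2"
    using low by (intro power_mono) (auto simp: d_def \<alpha>_def n_def)
  have f4: "(2 * \<alpha> - 1) * d \<le> n"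
  proof -
    have "d \<le> n" using card_common_nbrs_le[OF S(1), of E "{v}"] by (simp add: d_def n_def)
    moreover have "(2 * \<alpha> - 1) * d \<le> 1 * d" using \<alpha> by (intro mult_right_mono) (auto simp: d_def)
    ultimately show ?thesis by simp
  qed
  have f5: "\<epsilon> * n\<^sup>2 \<le> \<alpha> * (\<alpha> * n\<^sup>2) - ((\<alpha> - \<epsilon>) * n)\<^sup>2"
  proof -
    have "\<epsilon> * 1 \<le> \<epsilon> * (2 * \<alpha> - \<epsilon>)" using \<alpha> \<epsilon> by (intro mult_left_mono) auto
    then have "\<epsilon> * 1 * n\<^sup>2 \<le> \<epsilon> * (2 * \<alpha> - \<epsilon>) * n\<^sup>2" by (intro mult_right_mono) auto
    then show ?thesis by (simp add: power2_eq_square algebra_simps)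
  qed
  have f6: "3 * n \<le> \<epsilon> * n\<^sup>2"
    using mult_right_mono[OF n(2), of n] n(1) by (simp add: power2_eq_square mult_ac)
  have f7: "gap r E S - gap r E (S - {v}) = \<alpha> * (2 * m) - d\<^sup>2 - (2 * \<alpha> - 1) * d - 2 * (\<Sum>u\<in>common_nbrs E S {v}. y u)"
    using gap_delete_vertex[OF S v, of r] by (simp add: y_def n_def m_def d_def \<alpha>_def)
  have "g' + R / 2 \<le> g" if "P - Y \<le> G" "U \<le> Y" "D \<le> Q" "W \<le> n" "R \<le> P - Q" "3 * n \<le> R"
      "g - g' = G - D - W - 2 * U" "Y \<le> R / 20" "0 < n" for g g' R P G U D Q W :: real
    using that by linarith
  from this[OF f1 f2 f3 f4 f5 f6 f7 Y n(1)] show ?thesis by (simp add: n_def)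
qed

text \<open>Here \<open>x\<close> measures the imbalance of the classes and \<open>miss v\<close> the number of edges missing at \<open>v\<close>. Substitute
\<open>d(v) = n - n/r - x - miss v\<close> in \<open>gap = \<Sum>d(v)((1 - 1/r)n - d(v))\<close>, and use that the imbalances sum to
zero.\<close>

lemma multipartite_gap_eq:
  fixes c :: "'v \<Rightarrow> nat"
  assumes S: "finite S" "loopfree E" and r: "r > 0" and c: "\<And>v. v \<in> S \<Longrightarrow> c v < r"
  defines "n \<equiv> real (card S)"
  defines "x \<equiv> \<lambda>i. real (card {v \<in> S. c v = i}) - n / real r"
  defines "miss \<equiv> \<lambda>v. n - real (card {w \<in> S. c w = c v}) - real (deg E S v)"
  shows "gap r E S = (\<Sum>i<r. (x i)\<^sup>2 * ((1 - 2 / real r) * n - x i))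
      + (\<Sum>v\<in>S. miss v * (real (deg E S v) - x (c v)))"
proof -
  define \<beta> where "\<beta> = n / real r"
  have n: "n = real r * \<beta>" using r by (simp add: \<beta>_def)
  have group: "(\<Sum>v\<in>S. g (c v)) = (\<Sum>i<r. (x i + \<beta>) * g i)" for g
  proof -
    have "(\<Sum>v\<in>S. g (c v)) = (\<Sum>i<r. \<Sum>v\<in>{v \<in> S. c v = i}. g (c v))"
      using S c by (intro sum.group[symmetric]) auto
    also have "\<dots> = (\<Sum>i<r. (x i + \<beta>) * g i)"
      by (intro sum.cong) (auto simp: x_def \<beta>_def)
    finally show ?thesis .
  qed
  have sum_x: "(\<Sum>i<r. x i) = 0"
    using group[of "\<lambda>_. 1"] by (simp add: sum.distrib n_def[symmetric]) (simp add: n)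
  have "gap r E S = (1 - 1 / real r) * n * (\<Sum>v\<in>S. real (deg E S v)) - (\<Sum>v\<in>S. (real (deg E S v))\<^sup>2)"
    using sum_deg[OF S] by (simp add: gap_def n_def)
  also have "\<dots> = (\<Sum>v\<in>S. real (deg E S v) * ((1 - 1 / real r) * n - real (deg E S v)))"
  proof -
    have "A * (\<Sum>v\<in>S. f v) - (\<Sum>v\<in>S. (f v)\<^sup>2) = (\<Sum>v\<in>S. f v * (A - f v))" for A :: real and f
      by (simp add: sum_distrib_left sum_subtractf[symmetric] power2_eq_square algebra_simps)
    then show ?thesis .
  qed
  also have "\<dots> = (\<Sum>v\<in>S. x (c v) * (n - \<beta> - x (c v)) + miss v * (real (deg E S v) - x (c v)))"
    by (intro sum.cong) (auto simp: miss_def x_def \<beta>_def algebra_simps)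
  also have "\<dots> = (\<Sum>i<r. (x i + \<beta>) * (x i * (n - \<beta> - x i))) + (\<Sum>v\<in>S. miss v * (real (deg E S v) - x (c v)))"
    using group[of "\<lambda>i. x i * (n - \<beta> - x i)"] by (simp add: sum.distrib)
  also have "(\<Sum>i<r. (x i + \<beta>) * (x i * (n - \<beta> - x i)))
      = (\<Sum>i<r. (x i)\<^sup>2 * ((1 - 2 / real r) * n - x i) + (\<beta> * (n - \<beta>)) * x i)"
    using r by (intro sum.cong) (auto simp: n power2_eq_square field_simps)
  also have "\<dots> = (\<Sum>i<r. (x i)\<^sup>2 * ((1 - 2 / real r) * n - x i))"
    by (simp add: sum.distrib sum_distrib_left[symmetric] sum_x)
  finally show ?thesis .
qed

text \<open>The minimum degree makes both coefficients in \<open>multipartite_gap_eq\<close> positive, so the gap is a sum of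
nonnegative terms, all of which vanish only if the classes are balanced and no edge is missing.\<close>

lemma min_degree_multipartite_gap:
  fixes c :: "'v \<Rightarrow> nat" and \<epsilon> :: real
  assumes S: "finite S" "loopfree E" "S \<noteq> {}" and r: "r \<ge> 3" and \<epsilon>: "\<epsilon> \<le> 1 / 6"
    and c: "\<And>v. v \<in> S \<Longrightarrow> c v < r" "\<And>u v. u \<in> S \<Longrightarrow> v \<in> S \<Longrightarrow> {u, v} \<in> E \<Longrightarrow> c u \<noteq> c v"
    and deg: "\<And>v. v \<in> S \<Longrightarrow> (1 - 1 / real r - \<epsilon>) * real (card S) \<le> real (deg E S v)"
  shows "gap r E S \<ge> 0"
    and "gap r E S \<le> 0 \<Longrightarrow> i < r \<Longrightarrow> real (card {v \<in> S. c v = i}) = real (card S) / real r"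
    and "gap r E S \<le> 0 \<Longrightarrow> v \<in> S \<Longrightarrow> common_nbrs E S {v} = {w \<in> S. c w \<noteq> c v}"
proof -
  define n where "n = real (card S)"
  define x where "x i = real (card {v \<in> S. c v = i}) - n / real r" for i
  define miss where "miss v = n - real (card {w \<in> S. c w = c v}) - real (deg E S v)" for v
  define X where "X = (\<Sum>i<r. (x i)\<^sup>2 * ((1 - 2 / real r) * n - x i))"
  define M where "M = (\<Sum>v\<in>S. miss v * (real (deg E S v) - x (c v)))"
  have n: "n > 0" using S by (simp add: n_def card_gt_0_iff)
  have gap: "gap r E S = X + M"
    using multipartite_gap_eq[OF S(1,2) _ c(1)] r by (simp add: X_def M_def x_def miss_def n_def)
  have sub: "common_nbrs E S {v} \<subseteq> {w \<in> S. c w \<noteq> c v}" if "v \<in> S" for v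
  proof
    fix w assume "w \<in> common_nbrs E S {v}"
    then show "w \<in> {w \<in> S. c w \<noteq> c v}" using c(2)[of v w] that by (auto simp: common_nbrs_def)
  qed
  have card_other: "real (card {w \<in> S. c w \<noteq> c v}) = n - real (card {w \<in> S. c w = c v})" for v
  proof -
    have "{w \<in> S. c w \<noteq> c v} = S - {w \<in> S. c w = c v}" by auto
    then have "card {w \<in> S. c w \<noteq> c v} = card S - card {w \<in> S. c w = c v}"
      using S by (simp add: card_Diff_subset)
    moreover have "card {w \<in> S. c w = c v} \<le> card S" using S by (intro card_mono) auto
    ultimately show ?thesis by (simp add: n_def of_nat_diff)
  qed
  have miss0: "0 \<le> miss v" if "v \<in> S" for v
    using card_mono[OF _ sub[OF that]] S card_other[of v] by (simp add: miss_def)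
  have r3: "3 * (1 / real r) \<le> 1" "0 < 1 / real r" using r by (simp_all add: field_simps)
  have "1 / real r * n \<le> 1 / 3 * n" using r3 n by (intro mult_right_mono) auto
  then have n3: "n / real r \<le> n / 3" by simp
  have "\<epsilon> * n \<le> 1 / 6 * n" using \<epsilon> n by (intro mult_right_mono) auto
  then have \<epsilon>n: "\<epsilon> * n \<le> n / 6" by simp
  have degn: "n - n / real r - \<epsilon> * n \<le> real (deg E S v)" if "v \<in> S" for v
    using deg[OF that] by (simp add: n_def algebra_simps)
  have x_le: "x (c v) \<le> n / 6" if "v \<in> S" for v
    using miss0[OF that] degn[OF that] \<epsilon>n unfolding miss_def x_def by linarith
  have x_le': "x i \<le> n / 6" for i
  proof (cases "\<exists>v\<in>S. c v = i")
    case True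
    then show ?thesis using x_le by auto
  next
    case False
    then have "{v \<in> S. c v = i} = {}" by auto
    then have "x i = - (n / real r)" by (simp add: x_def del: Collect_empty_eq)
    moreover have "0 < n / real r" using n r by simp
    ultimately show ?thesis using n by linarith
  qed
  have pos_x: "0 < (1 - 2 / real r) * n - x i" for i
  proof -
    have "(1 - 2 / real r) * n = n - 2 * (n / real r)" by (simp add: algebra_simps)
    then show ?thesis using x_le'[of i] n3 n by linarith
  qed
  have pos_d: "0 < real (deg E S v) - x (c v)" if "v \<in> S" for v
    using degn[OF that] x_le[OF that] n3 \<epsilon>n n by linarith
  have X0: "0 \<le> X" unfolding X_def using pos_x by (intro sum_nonneg mult_nonneg_nonneg) (auto intro: less_imp_le)
  have M0: "0 \<le> M" unfolding M_def using pos_d miss0 by (intro sum_nonneg mult_nonneg_nonneg) (auto intro: less_imp_le)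
  show "gap r E S \<ge> 0" using gap X0 M0 by simp
  {
    assume "gap r E S \<le> 0"
    then have XM: "X = 0" "M = 0" using gap X0 M0 by auto
    have "(x i)\<^sup>2 * ((1 - 2 / real r) * n - x i) = 0" if "i < r" for i
      using XM(1) that pos_x unfolding X_def
      by (subst (asm) sum_nonneg_eq_0_iff) (auto intro!: mult_nonneg_nonneg intro: less_imp_le)
    moreover have "miss v * (real (deg E S v) - x (c v)) = 0" if "v \<in> S" for v
      using XM(2) that pos_d miss0 S unfolding M_def
      by (subst (asm) sum_nonneg_eq_0_iff) (auto intro!: mult_nonneg_nonneg intro: less_imp_le)
    ultimately have zero: "\<And>i. i < r \<Longrightarrow> x i = 0" "\<And>v. v \<in> S \<Longrightarrow> miss v = 0"
      using pos_x pos_d by (metis less_irrefl mult_eq_0_iff power2_eq_square)+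
    show "i < r \<Longrightarrow> real (card {v \<in> S. c v = i}) = real (card S) / real r"
      using zero(1)[of i] by (simp add: x_def n_def)
    show "common_nbrs E S {v} = {w \<in> S. c w \<noteq> c v}" if "v \<in> S"
    proof (rule card_subset_eq)
      show "card (common_nbrs E S {v}) = card {w \<in> S. c w \<noteq> c v}"
        using zero(2)[OF that] card_other[of v] by (simp add: miss_def)
    qed (use S sub that in auto)
  }
qed

lemma gap_eq_0_if_no_edges:
  assumes "finite S" "loopfree E" "cliques E S 2 = {}"
  shows "gap r E S = 0"
proof -
  have "(\<Sum>u\<in>S. real (deg E S u) * real (deg E S u)) = 0"
    using sum_edges_ends[OF assms(1,2), of "\<lambda>u. real (deg E S u)"] assms(3) by simp
  then show ?thesis using assms(3) by (simp add: gap_def power2_eq_square)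
qed

lemma gap_ge_minus_cube:
  assumes "finite S" "r > 0"
  shows "- (real (card S) ^ 3) \<le> gap r E S"
proof -
  have "(\<Sum>v\<in>S. (real (deg E S v))\<^sup>2) \<le> (\<Sum>v\<in>S. (real (card S))\<^sup>2)"
    using card_common_nbrs_le[OF assms(1)] by (intro sum_mono power_mono) auto
  also have "\<dots> = real (card S) ^ 3" by (simp add: power2_eq_square power3_eq_cube)
  finally have "(\<Sum>v\<in>S. (real (deg E S v))\<^sup>2) \<le> real (card S) ^ 3" .
  moreover have "0 \<le> 2 * (1 - 1 / real r) * real (card (cliques E S 2)) * real (card S)"
    using assms by (intro mult_nonneg_nonneg) auto
  ultimately show ?thesis by (simp add: gap_def)
qed

text \<open>Call \<open>n3\<close> the order from which on the concentration and colouring results apply. Removing low-degree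
vertices lowers the gap, and the process stops at order \<open>n3\<close> or at a graph of nonnegative gap, so the gap
is never below \<open>- n3\<^sup>3\<close>. For orders at which \<open>\<epsilon>n\<^sup>2/2\<close> exceeds \<open>n3\<^sup>3\<close>, a nonpositive gap excludes
low-degree vertices altogether.\<close>

theorem nonpos_gap_structure:
  assumes r: "r \<ge> 3" and N: "N > 0"
  shows "\<exists>n0. \<forall>E (S :: 'v set). finite S \<longrightarrow> loopfree E \<longrightarrow> n0 \<le> card S \<longrightarrow> plus_edge_free E S r N \<longrightarrow>
     cliques E S 2 \<noteq> {} \<longrightarrow> gap r E S \<le> 0 \<longrightarrow>
     (\<exists>c :: 'v \<Rightarrow> nat. (\<forall>v\<in>S. c v < r) \<and> (\<forall>i<r. real (card {v \<in> S. c v = i}) = real (card S) / real r) \<and>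
        (\<forall>v\<in>S. common_nbrs E S {v} = {w \<in> S. c w \<noteq> c v}))"
proof -
  have r0: "r > 0" using r by simp
  obtain \<epsilon>0 where \<epsilon>0: "\<epsilon>0 > 0" "\<And>\<epsilon>. 0 < \<epsilon> \<Longrightarrow> \<epsilon> \<le> \<epsilon>0 \<Longrightarrow> (\<exists>n0. \<forall>E (S :: 'v set). finite S \<longrightarrow> loopfree E \<longrightarrow>
     n0 \<le> card S \<longrightarrow> plus_edge_free E S r N \<longrightarrow>
     (\<forall>v\<in>S. (1 - 1 / real r - \<epsilon>) * real (card S) \<le> real (deg E S v)) \<longrightarrow>
     (\<exists>c :: 'v \<Rightarrow> nat. (\<forall>v\<in>S. c v < r) \<and> (\<forall>u\<in>S. \<forall>v\<in>S. {u, v} \<in> E \<longrightarrow> c u \<noteq> c v)))"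
    using min_degree_forces_colouring[OF N r0] by metis
  define \<epsilon> where "\<epsilon> = min \<epsilon>0 (1 / 6)"
  have \<epsilon>: "0 < \<epsilon>" "\<epsilon> \<le> \<epsilon>0" "\<epsilon> \<le> 1 / 6" using \<epsilon>0(1) by (auto simp: \<epsilon>_def)
  obtain n1 where n1: "\<And>E (S :: 'v set). finite S \<Longrightarrow> loopfree E \<Longrightarrow>
     n1 \<le> card S \<Longrightarrow> plus_edge_free E S r N \<Longrightarrow>
     (\<forall>v\<in>S. (1 - 1 / real r - \<epsilon>) * real (card S) \<le> real (deg E S v)) \<Longrightarrow>
     (\<exists>c :: 'v \<Rightarrow> nat. (\<forall>v\<in>S. c v < r) \<and> (\<forall>u\<in>S. \<forall>v\<in>S. {u, v} \<in> E \<longrightarrow> c u \<noteq> c v))"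
    using \<epsilon>0(2)[OF \<epsilon>(1,2)] by metis
  have "0 < \<epsilon>\<^sup>2 / 400" using \<epsilon> by simp
  from nonpos_gap_degrees_concentrate[OF this r N] obtain n2 where n2:
    "\<And>E (S :: 'v set). finite S \<Longrightarrow> loopfree E \<Longrightarrow> n2 \<le> card S \<Longrightarrow> plus_edge_free E S r N \<Longrightarrow>
      gap r E S \<le> 0 \<Longrightarrow> cliques E S 2 \<noteq> {} \<Longrightarrow>
      (\<Sum>u\<in>S. (real (deg E S u) - (1 - 1 / real r) * real (card S))\<^sup>2) \<le> \<epsilon>\<^sup>2 / 400 * real (card S) ^ 3"
    by metis
  define n3 where "n3 = max (max n1 n2) (nat \<lceil>3 / \<epsilon>\<rceil>)"
  have n3: "n1 \<le> n3" "n2 \<le> n3" "3 / \<epsilon> \<le> real n3" unfolding n3_def by linarith+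
  have dichotomy: "(\<exists>c :: 'v \<Rightarrow> nat. (\<forall>v\<in>S. c v < r) \<and> (\<forall>u\<in>S. \<forall>v\<in>S. {u, v} \<in> E \<longrightarrow> c u \<noteq> c v)) \<and>
        (\<forall>v\<in>S. (1 - 1 / real r - \<epsilon>) * real (card S) \<le> real (deg E S v)) \<or>
      (\<exists>v\<in>S. gap r E (S - {v}) + \<epsilon> / 2 * (real (card S))\<^sup>2 \<le> gap r E S)"
    if "finite S" "loopfree E" "n3 \<le> card S" "plus_edge_free E S r N" "gap r E S \<le> 0" "cliques E S 2 \<noteq> {}"
    for E and S :: "'v set"
  proof (cases "\<forall>v\<in>S. (1 - 1 / real r - \<epsilon>) * real (card S) \<le> real (deg E S v)")
    case True
    then show ?thesis using n1[OF that(1,2) _ that(4)] n3 that(3) by auto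
  next
    case False
    then obtain v where v: "v \<in> S" "real (deg E S v) < (1 - 1 / real r - \<epsilon>) * real (card S)"
      by (auto simp: not_le)
    have large: "n2 \<le> card S" "3 / \<epsilon> \<le> real (card S)" using n3 that(3) by linarith+
    show ?thesis
      using gap_drops_at_low_degree_vertex[OF that(1,2) v(1) r \<epsilon>(1,3) large(2) v(2)
          n2[OF that(1,2) large(1) that(4-6)]] v(1) by blast
  qed
  have lower: "- (real n3 ^ 3) \<le> gap r E S" if "finite S" "loopfree E" "plus_edge_free E S r N" for E and S :: "'v set"
    using that
  proof (induction "card S" arbitrary: S rule: less_induct)
    case less
    show ?case
    proof (cases "card S \<le> n3 \<or> gap r E S > 0 \<or> cliques E S 2 = {}")
      case True
      have "real (card S) ^ 3 \<le> real n3 ^ 3" if "card S \<le> n3" using that by (intro power_mono) auto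
      moreover have "0 \<le> real n3 ^ 3" by simp
      ultimately show ?thesis
        using True gap_ge_minus_cube[OF less.prems(1) r0, of E] gap_eq_0_if_no_edges[OF less.prems(1,2), of r]
        by linarith
    next
      case False
      then have big: "n3 \<le> card S" "gap r E S \<le> 0" "cliques E S 2 \<noteq> {}" by auto
      have ne: "S \<noteq> {}" using big by (auto simp: cliques_def)
      from dichotomy[OF less.prems(1,2) big(1) less.prems(3) big(2,3)] show ?thesis
      proof (elim disjE conjE exE bexE)
        fix c :: "'v \<Rightarrow> nat"
        assume "\<forall>v\<in>S. c v < r" "\<forall>u\<in>S. \<forall>v\<in>S. {u, v} \<in> E \<longrightarrow> c u \<noteq> c v"
          "\<forall>v\<in>S. (1 - 1 / real r - \<epsilon>) * real (card S) \<le> real (deg E S v)"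
        then have "0 \<le> gap r E S"
          by (intro min_degree_multipartite_gap(1)[OF less.prems(1,2) ne r \<epsilon>(3), of c]) auto
        then show ?thesis by (simp add: order_trans[of _ 0])
      next
        fix v assume v: "v \<in> S" "gap r E (S - {v}) + \<epsilon> / 2 * (real (card S))\<^sup>2 \<le> gap r E S"
        have "card (S - {v}) < card S" using v less.prems(1) by (intro card_Diff1_less)
        then have "- (real n3 ^ 3) \<le> gap r E (S - {v})"
          using less.hyps less.prems plus_edge_free_subset[of E S r N "S - {v}"] by auto
        moreover have "0 \<le> \<epsilon> / 2 * (real (card S))\<^sup>2" using \<epsilon> by simp
        ultimately show ?thesis using v(2) by linarith
      qed
    qed
  qed
  define n0 where "n0 = max n3 (nat \<lceil>2 * (real n3 ^ 3 + 1) / \<epsilon>\<rceil>)"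
  show ?thesis
  proof (intro exI[of _ n0] allI impI)
    fix E and S :: "'v set"
    assume S: "finite S" "loopfree E" and large: "n0 \<le> card S" and free: "plus_edge_free E S r N"
      and ne: "cliques E S 2 \<noteq> {}" and gap: "gap r E S \<le> 0"
    have S_ne: "S \<noteq> {}" using ne by (auto simp: cliques_def)
    have "n3 \<le> card S" using large by (simp add: n0_def)
    from dichotomy[OF S this free gap ne]
    show "\<exists>c :: 'v \<Rightarrow> nat. (\<forall>v\<in>S. c v < r) \<and> (\<forall>i<r. real (card {v \<in> S. c v = i}) = real (card S) / real r) \<and>
        (\<forall>v\<in>S. common_nbrs E S {v} = {w \<in> S. c w \<noteq> c v})"
    proof (elim disjE conjE exE bexE)
      fix c :: "'v \<Rightarrow> nat"
      assume *: "\<forall>v\<in>S. c v < r" "\<forall>u\<in>S. \<forall>v\<in>S. {u, v} \<in> E \<longrightarrow> c u \<noteq> c v"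
        "\<forall>v\<in>S. (1 - 1 / real r - \<epsilon>) * real (card S) \<le> real (deg E S v)"
      have c: "\<And>v. v \<in> S \<Longrightarrow> c v < r" "\<And>u v. u \<in> S \<Longrightarrow> v \<in> S \<Longrightarrow> {u, v} \<in> E \<Longrightarrow> c u \<noteq> c v"
        "\<And>v. v \<in> S \<Longrightarrow> (1 - 1 / real r - \<epsilon>) * real (card S) \<le> real (deg E S v)"
        using * by blast+
      note balanced = min_degree_multipartite_gap(2,3)[OF S S_ne r \<epsilon>(3) c gap]
      show ?thesis
        by (intro exI[of _ c] conjI ballI allI impI) (rule c(1) balanced; assumption)+
    next
      fix v assume v: "v \<in> S" "gap r E (S - {v}) + \<epsilon> / 2 * (real (card S))\<^sup>2 \<le> gap r E S"
      have "nat \<lceil>2 * (real n3 ^ 3 + 1) / \<epsilon>\<rceil> \<le> card S" using large by (simp add: n0_def)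
      then have "2 * (real n3 ^ 3 + 1) / \<epsilon> \<le> real (card S)"
        using real_nat_ceiling_ge[of "2 * (real n3 ^ 3 + 1) / \<epsilon>"] by (meson of_nat_le_iff order_trans)
      then have "real n3 ^ 3 + 1 \<le> \<epsilon> / 2 * real (card S)" using \<epsilon> by (simp add: field_simps)
      also have "\<dots> \<le> \<epsilon> / 2 * (real (card S))\<^sup>2"
      proof -
        have "1 \<le> real (card S)" using S S_ne by (simp add: Suc_le_eq card_gt_0_iff)
        then have "real (card S) \<le> (real (card S))\<^sup>2" by (simp add: power2_eq_square)
        then show ?thesis using \<epsilon> by (intro mult_left_mono) auto
      qed
      finally have "real n3 ^ 3 + 1 \<le> \<epsilon> / 2 * (real (card S))\<^sup>2" .
      moreover have "- (real n3 ^ 3) \<le> gap r E (S - {v})"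
        using lower S plus_edge_free_subset[OF free] by auto
      ultimately show ?thesis using v(2) gap by linarith
    qed
  qed
qed

section \<open>Color-critical graphs and the theorem\<close>

lemma loopfree_edges: "simple_graph G \<Longrightarrow> loopfree (edges G)"
  by (force simp: simple_graph_def loopfree_def)

lemma cliques_2_edges:
  assumes "simple_graph G"
  shows "cliques (edges G) (verts G) 2 = edges G"
proof -
  have "e \<in> cliques (edges G) (verts G) 2 \<longleftrightarrow> e \<in> edges G" for e
  proof (cases "card e = 2")
    case True
    then obtain u v where "e = {u, v}" "u \<noteq> v" by (auto simp: card_2_iff)
    then show ?thesis using assms True by (auto simp: cliques_def simple_graph_def insert_commute)
  next
    case False
    then show ?thesis using assms by (auto simp: cliques_def simple_graph_def)
  qed
  then show ?thesis by blast
qed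

lemma degree_eq_deg:
  assumes "simple_graph G"
  shows "degree G v = deg (edges G) (verts G) v"
proof -
  have "{e \<in> edges G. v \<in> e} = (\<lambda>w. {v, w}) ` common_nbrs (edges G) (verts G) {v}"
  proof (intro set_eqI iffI)
    fix e assume e: "e \<in> {e \<in> edges G. v \<in> e}"
    then have "card e = 2" "e \<subseteq> verts G" using assms by (auto simp: simple_graph_def)
    with e obtain w where "e = {v, w}" by (auto simp: card_2_iff)
    then show "e \<in> (\<lambda>w. {v, w}) ` common_nbrs (edges G) (verts G) {v}"
      using e \<open>e \<subseteq> verts G\<close> by (auto simp: common_nbrs_def)
  qed (auto simp: common_nbrs_def)
  moreover have "inj_on (\<lambda>w. {v, w}) (common_nbrs (edges G) (verts G) {v})"
    by (auto simp: inj_on_def doubleton_eq_iff)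
  ultimately show ?thesis by (simp add: degree_def card_image)
qed

lemma colorable_chromatic_number:
  assumes "simple_graph G"
  shows "colorable G (chromatic_number G)"
proof -
  obtain f :: "'a \<Rightarrow> nat" and n where f: "f ` verts G = {i. i < n}" "inj_on f (verts G)"
    using finite_imp_inj_to_nat_seg[of "verts G"] assms by (auto simp: simple_graph_def)
  have "f u \<noteq> f v" if uv: "{u, v} \<in> edges G" for u v
  proof -
    have "card {u, v} = 2" "{u, v} \<subseteq> verts G" using assms uv by (auto simp: simple_graph_def)
    then have "u \<noteq> v" "u \<in> verts G" "v \<in> verts G" by (auto simp: card_2_iff')
    then show ?thesis using f(2) by (auto simp: inj_on_def)
  qed
  then have "colorable G n" using f(1) unfolding colorable_def by (intro exI[of _ f]) auto
  then show ?thesis unfolding chromatic_number_def by (rule LeastI)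
qed

text \<open>Colour \<open>F\<close> without its critical edge with \<open>r\<close> colours. The ends \<open>a\<close> and \<open>b\<close> of that edge receive the same colour, since
otherwise the colouring would be a proper \<open>r\<close>-colouring of \<open>F\<close>.\<close>

lemma color_critical_colouring:
  assumes "simple_graph F" "color_critical F" "chromatic_number F = r + 1"
  obtains c :: "'a \<Rightarrow> nat" and a b where "{a, b} \<in> edges F" "c a = c b"
    "\<And>v. v \<in> verts F \<Longrightarrow> c v < r"
    "\<And>u v. {u, v} \<in> edges F \<Longrightarrow> {u, v} \<noteq> {a, b} \<Longrightarrow> c u \<noteq> c v"
proof -
  obtain e where e: "e \<in> edges F" "chromatic_number (delete_edge F e) < chromatic_number F"
    using assms(2) by (auto simp: color_critical_def)
  have "simple_graph (delete_edge F e)" using assms(1) by (auto simp: simple_graph_def delete_edge_def)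
  then have "colorable (delete_edge F e) (chromatic_number (delete_edge F e))"
    by (rule colorable_chromatic_number)
  then obtain c :: "'a \<Rightarrow> nat" where c: "\<And>v. v \<in> verts F \<Longrightarrow> c v < chromatic_number (delete_edge F e)"
    "\<And>u v. {u, v} \<in> edges F - {e} \<Longrightarrow> c u \<noteq> c v"
    by (auto simp: colorable_def delete_edge_def)
  have lt: "c v < r" if "v \<in> verts F" for v using c(1)[OF that] e(2) assms(3) by simp
  have "card e = 2" using assms(1) e(1) by (auto simp: simple_graph_def)
  then obtain a b where ab: "e = {a, b}" by (auto simp: card_2_iff)
  have "c a = c b"
  proof (rule ccontr)
    assume ne: "c a \<noteq> c b"
    have "c u \<noteq> c v" if "{u, v} \<in> edges F" for u v
      using c(2)[of u v] that ne ab by (cases "{u, v} = e") (auto simp: doubleton_eq_iff)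
    then have "colorable F r" using lt unfolding colorable_def by blast
    then have "chromatic_number F \<le> r" unfolding chromatic_number_def by (rule Least_le)
    then show False using assms(3) by simp
  qed
  then show ?thesis using that[of a b c] e(1) ab lt c(2) by blast
qed

text \<open>Map each colour class of \<open>F\<close> minus the critical edge into one part of the family, sending the critical edge
to the extra edge. For this the part containing the extra edge is exchanged with the part indexed by
the colour of \<open>a\<close> and \<open>b\<close>.\<close>

lemma free_of_imp_plus_edge_free:
  fixes F :: "'a sgraph" and G :: "'b sgraph"
  assumes F: "simple_graph F" "color_critical F" "chromatic_number F = r + 1"
    and G: "simple_graph G" "free_of F G"
  shows "plus_edge_free (edges G) (verts G) r (card (verts F))"
proof (rule ccontr)
  define N where "N = card (verts F)"
  have lf: "loopfree (edges G)" using G(1) by (rule loopfree_edges)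
  assume "\<not> ?thesis"
  then have "\<exists>P i u v. joined (edges G) r P \<and> (\<forall>j<r. P j \<subseteq> verts G \<and> N \<le> card (P j)) \<and>
      i < r \<and> u \<in> P i \<and> v \<in> P i \<and> {u, v} \<in> edges G"
    unfolding plus_edge_free_def N_def by (rule notnotD)
  then obtain P0 i u v where P0: "joined (edges G) r P0"
    "\<forall>j<r. P0 j \<subseteq> verts G \<and> N \<le> card (P0 j)" "i < r" "u \<in> P0 i" "v \<in> P0 i" "{u, v} \<in> edges G"
    by (elim exE conjE) (rule that)
  obtain c a b where c: "{a, b} \<in> edges F" "c a = c b" "\<And>v. v \<in> verts F \<Longrightarrow> c v < r"
    "\<And>u v. {u, v} \<in> edges F \<Longrightarrow> {u, v} \<noteq> {a, b} \<Longrightarrow> c u \<noteq> (c v :: nat)"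
    by (rule color_critical_colouring[OF F]) (rule that)
  have finF: "finite (verts F)" and finG: "finite (verts G)" using F G by (auto simp: simple_graph_def)
  have "card {a, b} = 2" "{a, b} \<subseteq> verts F" using F(1) c(1) by (auto simp: simple_graph_def)
  then have ab: "a \<noteq> b" "a \<in> verts F" "b \<in> verts F" by (auto simp: card_2_iff')
  have uv: "u \<noteq> v" using P0(6) lf by (auto simp: loopfree_def)
  define P where "P j = (if j = c a then P0 i else if j = i then P0 (c a) else P0 j)" for j
  have ca: "c a < r" using c(3) ab by blast
  have P: "joined (edges G) r P" "\<And>j. j < r \<Longrightarrow> P j \<subseteq> verts G \<and> N \<le> card (P j)" "u \<in> P (c a)" "v \<in> P (c a)"
  proof -
    show "joined (edges G) r P"
      using P0(1,3) ca unfolding joined_def P_def by (auto split: if_splits)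
  qed (use P0 ca in \<open>auto simp: P_def\<close>)
  have "\<exists>g. g ` ({x \<in> verts F. c x = j} - {a, b}) \<subseteq> P j - {u, v} \<and> inj_on g ({x \<in> verts F. c x = j} - {a, b})"
    if j: "j < r" for j
  proof -
    have finP: "finite (P j)" using P(2)[OF j] finG finite_subset by blast
    have "card ({x \<in> verts F. c x = j} - {a, b}) \<le> card (verts F - {a, b})"
      using finF by (intro card_mono) auto
    also have "\<dots> = N - 2" using ab by (simp add: N_def card_Diff_subset)
    also have "\<dots> \<le> card (P j) - card {u, v}" using P(2)[OF j] uv by (simp add: numeral_2_eq_2 diff_le_mono)
    also have "\<dots> \<le> card (P j - {u, v})" by (rule diff_card_le_card_Diff) simp
    finally have le: "card ({x \<in> verts F. c x = j} - {a, b}) \<le> card (P j - {u, v})" .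
    show ?thesis by (rule card_le_inj[OF _ _ le]) (use finF finP in auto)
  qed
  note ex_inj = this
  \<comment> \<open>The remaining vertices of each class avoid \<open>u\<close> and \<open>v\<close>; removing two vertices on each side keeps enough room.\<close>
  define g where "g j = (SOME h. h ` ({x \<in> verts F. c x = j} - {a, b}) \<subseteq> P j - {u, v} \<and>
      inj_on h ({x \<in> verts F. c x = j} - {a, b}))" for j
  have g: "inj_on (g j) ({x \<in> verts F. c x = j} - {a, b})"
    "g j ` ({x \<in> verts F. c x = j} - {a, b}) \<subseteq> P j - {u, v}" if "j < r" for j
    using someI_ex[OF ex_inj[OF that]] unfolding g_def by blast+
  define f where "f x = (if x = a then u else if x = b then v else g (c x) x)" for x
  have g_in: "g (c x) x \<in> P (c x) - {u, v}" if "x \<in> verts F" "x \<noteq> a" "x \<noteq> b" for x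
    using g(2)[OF c(3)[OF that(1)]] that by blast
  have f_in: "f x \<in> P (c x)" if "x \<in> verts F" for x
    using g_in[OF that] P(3,4) c(2) by (auto simp: f_def)
  have f_edge: "{f x, f y} \<in> edges G" if "x \<in> verts F" "y \<in> verts F" "c x \<noteq> c y" for x y
    using joinedD[OF P(1) c(3)[OF that(1)] c(3)[OF that(2)] that(3) f_in[OF that(1)] f_in[OF that(2)]] .
  have inj: "inj_on f (verts F)"
  proof (rule inj_onI)
    fix x y assume xy: "x \<in> verts F" "y \<in> verts F" "f x = f y"
    have same: "c x = c y" using f_edge[OF xy(1,2)] xy(3) lf by (auto simp: loopfree_def)
    show "x = y"
    proof (cases "x \<in> {a, b} \<or> y \<in> {a, b}")
      case True
      then show ?thesis using xy uv ab g_in[of x] g_in[of y] by (auto simp: f_def split: if_splits)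
    next
      case False
      then have "g (c x) x = g (c x) y" using xy same by (simp add: f_def)
      then show ?thesis using inj_onD[OF g(1)[OF c(3)[OF xy(1)]]] xy same False by auto
    qed
  qed
  have f_edges: "f ` e \<in> edges G" if e: "e \<in> edges F" for e
  proof -
    have "card e = 2" "e \<subseteq> verts F" using F(1) e by (auto simp: simple_graph_def)
    then obtain x y where xy: "e = {x, y}" "x \<in> verts F" "y \<in> verts F" by (auto simp: card_2_iff)
    show ?thesis
    proof (cases "e = {a, b}")
      case True
      then show ?thesis using P0(6) ab by (simp add: f_def insert_commute)
    next
      case False
      then have "c x \<noteq> c y" using c(4)[of x y] e xy(1) by simp
      then show ?thesis using f_edge[OF xy(2,3)] xy(1) by simp
    qed
  qed
  define H :: "'b sgraph" where "H = \<lparr>verts = f ` verts F, edges = (`) f ` edges F\<rparr>"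
  have "subgraph H G"
    unfolding subgraph_def
  proof (intro conjI)
    show "simple_graph H"
      unfolding simple_graph_def
    proof (intro conjI ballI)
      show "finite (verts H)" using finF by (simp add: H_def)
      fix e' assume "e' \<in> edges H"
      then obtain e where e: "e' = f ` e" "e \<in> edges F" by (auto simp: H_def)
      then have "card e = 2" "e \<subseteq> verts F" using F(1) by (auto simp: simple_graph_def)
      then show "e' \<subseteq> verts H" "card e' = 2"
        using e card_image[OF inj_on_subset[OF inj]] by (auto simp: H_def)
    qed
    show "verts H \<subseteq> verts G" using f_in c(3) P(2) by (force simp: H_def)
    show "edges H \<subseteq> edges G" using f_edges by (auto simp: H_def)
  qed
  moreover have "isomorphic F H"
    unfolding isomorphic_def
  proof (intro exI[of _ f] conjI ballI)
    show "bij_betw f (verts F) (verts H)" using inj by (simp add: bij_betw_def H_def)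
    fix x y assume xy: "x \<in> verts F" "y \<in> verts F"
    show "{x, y} \<in> edges F \<longleftrightarrow> {f x, f y} \<in> edges H"
    proof
      assume "{x, y} \<in> edges F"
      then have "f ` {x, y} \<in> edges H" unfolding H_def by (metis imageI select_convs(2))
      then show "{f x, f y} \<in> edges H" by simp
    next
      assume "{f x, f y} \<in> edges H"
      then obtain e where e: "e \<in> edges F" "f ` e = f ` {x, y}" by (auto simp: H_def)
      moreover have "e \<subseteq> verts F" using F(1) e(1) by (auto simp: simple_graph_def)
      ultimately have "e = {x, y}" using inj_on_image_eq_iff[OF inj, of e "{x, y}"] xy by auto
      then show "{x, y} \<in> edges F" using e by simp
    qed
  qed
  ultimately show False using G(2) unfolding free_of_def by blast
qed

text \<open>Regularity makes all parts equal, so every vertex has degree exactly \<open>(1 - 1/r)n\<close>.\<close>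

lemma regular_complete_partite_gap:
  assumes G: "simple_graph G" and part: "complete_partite r G" and reg: "regular G" and r: "r > 0"
  shows "gap r (edges G) (verts G) = 0"
proof -
  define S E where "S = verts G" and "E = edges G"
  have S: "finite S" "loopfree E" using G loopfree_edges by (auto simp: simple_graph_def S_def E_def)
  obtain \<P> where \<P>: "partition_on S \<P>" "finite \<P>" "card \<P> = r"
    "\<And>u v. u \<in> S \<Longrightarrow> v \<in> S \<Longrightarrow> {u, v} \<in> E \<longleftrightarrow> \<not> (\<exists>p\<in>\<P>. u \<in> p \<and> v \<in> p)"
    using part unfolding complete_partite_def S_def E_def by blast
  define n where "n = real (card S)"
  have "\<P> \<noteq> {}" using \<P>(3) r by auto
  then obtain p0 where "p0 \<in> \<P>" by blast
  then obtain v0 where v0: "v0 \<in> S"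
    using \<P>(1) unfolding partition_on_def by (metis UnionI equals0I)
  define d where "d = real (deg E S v0)"
  have degs: "real (deg E S v) = d" if "v \<in> S" for v
    using reg that v0 degree_eq_deg[OF G] unfolding regular_def S_def E_def d_def by metis
  have part_size: "real (card p) = n - d" if p: "p \<in> \<P>" for p
  proof -
    have "p \<subseteq> S" "p \<noteq> {}" using \<P>(1) p unfolding partition_on_def by auto
    then obtain v where v: "v \<in> p" "v \<in> S" by blast
    have "common_nbrs E S {v} = S - p"
    proof -
      have same: "q = p" if "q \<in> \<P>" "v \<in> q" for q
        using disjointD[OF partition_onD2[OF \<P>(1)] that(1) p] that(2) v(1) by blast
      have "{v, w} \<in> E \<longleftrightarrow> w \<notin> p" if "w \<in> S" for w
        using \<P>(4)[OF v(2) that] same p v(1) by blast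
      then show ?thesis by (auto simp: common_nbrs_def)
    qed
    then have "deg E S v = card S - card p" using \<open>p \<subseteq> S\<close> S by (simp add: card_Diff_subset finite_subset)
    moreover have "card p \<le> card S" using \<open>p \<subseteq> S\<close> S by (intro card_mono) auto
    ultimately show ?thesis using degs[OF v(2)] by (simp add: n_def of_nat_diff)
  qed
  have "card (\<Union>\<P>) = (\<Sum>p\<in>\<P>. card p)"
    using \<P>(1) S by (intro card_Union_disjoint) (auto simp: partition_on_def pairwise_def disjoint_def disjnt_def intro: finite_subset)
  then have "n = (\<Sum>p\<in>\<P>. real (card p))" using \<P>(1) by (simp add: partition_on_def n_def)
  also have "\<dots> = real r * (n - d)" using part_size \<P>(3) by simp
  finally have d: "(1 - 1 / real r) * n = d" using r by (simp add: field_simps)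
  have "2 * real (card (cliques E S 2)) = n * d"
    using sum_deg[OF S] degs by (simp add: n_def)
  moreover have "(\<Sum>v\<in>S. (real (deg E S v))\<^sup>2) = n * d\<^sup>2" using degs by (simp add: n_def)
  moreover have "gap r E S = (1 - 1 / real r) * n * (2 * real (card (cliques E S 2))) - (\<Sum>v\<in>S. (real (deg E S v))\<^sup>2)"
    by (simp add: gap_def n_def)
  ultimately have "gap r E S = n * d * ((1 - 1 / real r) * n) - n * d\<^sup>2" by simp
  then show ?thesis unfolding d by (simp add: power2_eq_square S_def E_def)
qed

lemma balanced_colouring_regular_complete_partite:
  fixes c :: "'a \<Rightarrow> nat"
  assumes G: "simple_graph G" and ne: "verts G \<noteq> {}" and r: "r > 0"
    and c: "\<And>v. v \<in> verts G \<Longrightarrow> c v < r"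
    and size: "\<And>i. i < r \<Longrightarrow> real (card {v \<in> verts G. c v = i}) = real (card (verts G)) / real r"
    and nbs: "\<And>v. v \<in> verts G \<Longrightarrow> common_nbrs (edges G) (verts G) {v} = {w \<in> verts G. c w \<noteq> c v}"
  shows "complete_partite r G" "regular G"
proof -
  define S where "S = verts G"
  have S: "finite S" using G by (simp add: simple_graph_def S_def)
  define V where "V i = {v \<in> S. c v = i}" for i
  have V_ne: "V i \<noteq> {}" if "i < r" for i
  proof
    assume "V i = {}"
    moreover have "real (card (V i)) = real (card S) / real r" using size[OF that] by (simp add: V_def S_def)
    ultimately have "real (card S) / real r = 0" by simp
    then show False using S ne r by (simp add: S_def)
  qed
  have V_inj: "inj_on V {..<r}"
    using V_ne by (force simp: inj_on_def V_def)
  have "{u, v} \<in> edges G \<longleftrightarrow> \<not> (\<exists>p\<in>V ` {..<r}. u \<in> p \<and> v \<in> p)" if uv: "u \<in> S" "v \<in> S" for u v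
  proof -
    have "{u, v} \<in> edges G \<longleftrightarrow> v \<in> common_nbrs (edges G) (verts G) {u}" using uv by (simp add: common_nbrs_def S_def)
    also have "\<dots> \<longleftrightarrow> c v \<noteq> c u" using nbs[of u] uv by (simp add: S_def)
    finally show ?thesis using uv c by (auto simp: V_def S_def)
  qed
  moreover have "partition_on S (V ` {..<r})"
    using V_ne c by (auto simp: partition_on_def V_def S_def disjoint_def)
  ultimately show "complete_partite r G"
    unfolding complete_partite_def using card_image[OF V_inj]
    by (intro exI[of _ "V ` {..<r}"]) (auto simp: S_def)
  have "real (degree G v) = real (card S) - real (card S) / real r" if v: "v \<in> S" for v
  proof -
    have "{w \<in> S. c w \<noteq> c v} = S - V (c v)" by (auto simp: V_def)
    then have "degree G v = card S - card (V (c v))"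
      using degree_eq_deg[OF G, of v] nbs[of v] v S by (simp add: S_def[symmetric] V_def card_Diff_subset)
    moreover have "card (V (c v)) \<le> card S" using S by (intro card_mono) (auto simp: V_def)
    ultimately show ?thesis using size[of "c v"] c v by (simp add: of_nat_diff V_def S_def)
  qed
  then show "regular G" unfolding regular_def S_def by (metis of_nat_eq_iff)
qed

(* G ranges over graphs with vertices in nat: every finite graph is isomorphic to one of these,
   and a fixed vertex type makes n0 depend on F only.
   The equality case needs m > 0, since an edgeless graph satisfies 0 = 0. *)
theorem theorem2p6:
  fixes F :: "'a sgraph" and r :: nat
  assumes "simple_graph F"
    and "color_critical F"
    and "chromatic_number F = r + 1"
    and "r + 1 \<ge> 4"
  shows "\<exists>n0 :: nat. \<forall>(G :: nat sgraph) (n :: nat) (m :: nat).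
    simple_graph G \<and> free_of F G \<and> card (verts G) = n \<and> card (edges G) = m \<and> n \<ge> n0 \<longrightarrow>
      (\<Sum>v\<in>verts G. real (degree G v) ^ 2) \<le> 2 * (1 - 1 / real r) * real m * real n \<and>
      (m > 0 \<longrightarrow>
        ((\<Sum>v\<in>verts G. real (degree G v) ^ 2) = 2 * (1 - 1 / real r) * real m * real n \<longleftrightarrow>
          complete_partite r G \<and> regular G))"
proof -
  have r: "r \<ge> 3" "r > 0" using assms(4) by auto
  define N where "N = card (verts F)"
  have "N > 0"
  proof -
    obtain e where "e \<in> edges F" using assms(2) by (auto simp: color_critical_def)
    then have "card e = 2" "e \<subseteq> verts F" "finite (verts F)" using assms(1) by (auto simp: simple_graph_def)
    then show ?thesis unfolding N_def by (auto simp: card_gt_0_iff)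
  qed
  obtain n0 where n0: "\<forall>E (S :: nat set). finite S \<longrightarrow> loopfree E \<longrightarrow> n0 \<le> card S \<longrightarrow> plus_edge_free E S r N \<longrightarrow>
     cliques E S 2 \<noteq> {} \<longrightarrow> gap r E S \<le> 0 \<longrightarrow>
     (\<exists>c :: nat \<Rightarrow> nat. (\<forall>v\<in>S. c v < r) \<and> (\<forall>i<r. real (card {v \<in> S. c v = i}) = real (card S) / real r) \<and>
        (\<forall>v\<in>S. common_nbrs E S {v} = {w \<in> S. c w \<noteq> c v}))"
    using nonpos_gap_structure[OF r(1) \<open>N > 0\<close>] by (elim exE) (rule that)
  show ?thesis
  proof (intro exI[of _ n0] allI impI)
    fix G :: "nat sgraph" and n m :: nat
    assume "simple_graph G \<and> free_of F G \<and> card (verts G) = n \<and> card (edges G) = m \<and> n \<ge> n0"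
    then have G: "simple_graph G" "free_of F G" "card (verts G) = n" "card (edges G) = m" "n \<ge> n0" by auto
    define g where "g = gap r (edges G) (verts G)"
    have S: "finite (verts G)" "loopfree (edges G)"
      using G(1) loopfree_edges by (auto simp: simple_graph_def)
    have g: "g = 2 * (1 - 1 / real r) * real m * real n - (\<Sum>v\<in>verts G. real (degree G v) ^ 2)"
      using G(3,4) by (simp add: g_def gap_def cliques_2_edges[OF G(1)] degree_eq_deg[OF G(1)])
    have extremal: "complete_partite r G \<and> regular G" if pos: "m > 0" "g \<le> 0"
    proof -
      have ne: "cliques (edges G) (verts G) 2 \<noteq> {}"
        using pos G(4) by (auto simp: cliques_2_edges[OF G(1)])
      then have "verts G \<noteq> {}" by (auto simp: cliques_def)
      have free: "plus_edge_free (edges G) (verts G) r N"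
        using free_of_imp_plus_edge_free[OF assms(1-3) G(1,2)] by (simp add: N_def)
      have large: "n0 \<le> card (verts G)" using G(3,5) by simp
      have nonpos: "gap r (edges G) (verts G) \<le> 0" using pos(2) by (simp add: g_def)
      obtain c where c: "\<forall>v\<in>verts G. c v < r"
        "\<forall>i<r. real (card {v \<in> verts G. c v = i}) = real (card (verts G)) / real r"
        "\<forall>v\<in>verts G. common_nbrs (edges G) (verts G) {v} = {w \<in> verts G. c w \<noteq> (c v :: nat)}"
        using n0[rule_format, OF S large free ne nonpos] by (elim exE conjE) (rule that)
      show ?thesis
        by (intro conjI balanced_colouring_regular_complete_partite[OF G(1) \<open>verts G \<noteq> {}\<close> r(2) c[rule_format]])
    qed
    have tight: "g = 0" if "complete_partite r G \<and> regular G"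
      using regular_complete_partite_gap[OF G(1) _ _ r(2)] that by (simp add: g_def)
    have edgeless: "g = 0" if "m = 0"
    proof -
      have "finite (edges G)" using finite_cliques[OF S(1), of "edges G" 2] cliques_2_edges[OF G(1)] by simp
      then have "edges G = {}" using that G(4) by simp
      then show ?thesis using gap_eq_0_if_no_edges[OF S, of r] cliques_2_edges[OF G(1)] by (simp add: g_def)
    qed
    have "0 \<le> g"
    proof (rule ccontr)
      assume "\<not> 0 \<le> g"
      then have neg: "g < 0" by simp
      then have "m > 0" using edgeless by (cases "m = 0") auto
      then have "complete_partite r G \<and> regular G" using neg by (intro extremal) auto
      then have "g = 0" by (rule tight)
      with neg show False by simp
    qed
    show "(\<Sum>v\<in>verts G. real (degree G v) ^ 2) \<le> 2 * (1 - 1 / real r) * real m * real n \<and>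
      (m > 0 \<longrightarrow>
        ((\<Sum>v\<in>verts G. real (degree G v) ^ 2) = 2 * (1 - 1 / real r) * real m * real n \<longleftrightarrow>
          complete_partite r G \<and> regular G))"
    proof (intro conjI impI)
      show le: "(\<Sum>v\<in>verts G. real (degree G v) ^ 2) \<le> 2 * (1 - 1 / real r) * real m * real n"
        using \<open>0 \<le> g\<close> by (simp only: g diff_ge_0_iff_ge)
      assume "m > 0"
      have "(\<Sum>v\<in>verts G. real (degree G v) ^ 2) = 2 * (1 - 1 / real r) * real m * real n \<longleftrightarrow> g \<le> 0"
        unfolding g diff_le_0_iff_le using le by (metis antisym order_refl)
      also have "\<dots> \<longleftrightarrow> complete_partite r G \<and> regular G"
      proof
        assume "g \<le> 0"
        then show "complete_partite r G \<and> regular G" by (rule extremal[OF \<open>m > 0\<close>])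
      next
        assume "complete_partite r G \<and> regular G"
        then show "g \<le> 0" by (simp only: tight)
      qed
      finally show "(\<Sum>v\<in>verts G. real (degree G v) ^ 2) = 2 * (1 - 1 / real r) * real m * real n \<longleftrightarrow>
          complete_partite r G \<and> regular G" .
    qed
  qed
qed

end
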